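(* Let $n>2$. In $\mathbf{P}^{\frac{n+p}{2}}(\mathbf{C})$ there exists neither an $n$-dimensional totally geodesic CR submanifold of maximal CR dimension whose normal connection is flat, nor an $n$-dimensional totally umbilical CR submanifold of maximal CR dimension whose normal connection is flat.
   Context: All manifolds are smooth and nonempty. $\mathbf{P}^{\frac{n+p}{2}}(\mathbf{C})$ is the complex projective space of complex dimension $\frac{n+p}{2}$ with the Fubini–Study metric of constant holomorphic sectional curvature $4$ and complex structure $J$. For an $n$-dimensional real submanifold $M^n$ (so of real codimension $p\geq 1$) and $x\in M^n$, the holomorphic tangent space is $H_x(M^n)=JT_x(M^n)\cap T_x(M^n)$. $M^n$ is a CR submanifold of maximal CR dimension if $\dim_{\mathbf{R}}H_x(M^n)=n-1$ for every $x\in M^n$ (so $n$ is odd). The normal connection is flat if its curvature tensor $R^{\perp}$ vanishes (this is automatic when $p=1$). $M^n$ is totally geodesic if its second fundamental form vanishes, and totally umbilical if every normal vector $\eta$ is umbilical, i.e. the shape operator $A_\eta$ equals $\langle\eta,\zeta\rangle\,\mathrm{id}$, where $\zeta$ is the mean curvature vector ($\frac1n$ times the trace of the second fundamental form). *)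

theory Defs
  imports "HOL-Analysis.Analysis"
begin

section \<open>Smooth maps and smooth manifolds\<close>

text \<open>For open \<open>S\<close>: all iterated directional derivatives up to order \<open>k\<close> exist and are
  continuous.\<close>

primrec Ck_on :: "nat \<Rightarrow> 'a::euclidean_space set \<Rightarrow> ('a \<Rightarrow> 'b::euclidean_space) \<Rightarrow> bool" where
  "Ck_on 0 S f \<longleftrightarrow> continuous_on S f"
| "Ck_on (Suc k) S f \<longleftrightarrow>
     (\<forall>x\<in>S. f differentiable (at x)) \<and> (\<forall>v. Ck_on k S (\<lambda>x. frechet_derivative f (at x) v))"

definition smooth_on :: "'a::euclidean_space set \<Rightarrow> ('a \<Rightarrow> 'b::euclidean_space) \<Rightarrow> bool" where
  "smooth_on S f \<longleftrightarrow> (\<forall>k. Ck_on k S f)"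

type_synonym ('a, 'e) chart = "'a set \<times> ('a \<Rightarrow> 'e)"

definition is_chart :: "'a topology \<Rightarrow> ('a, 'e::euclidean_space) chart \<Rightarrow> bool" where
  "is_chart X = (\<lambda>(U, \<phi>). openin X U \<and> open (\<phi> ` U) \<and>
     homeomorphic_map (subtopology X U) (top_of_set (\<phi> ` U)) \<phi>)"

definition smooth_manifold :: "'a topology \<Rightarrow> ('a, 'e::euclidean_space) chart set \<Rightarrow> bool" where
  "smooth_manifold X A \<longleftrightarrow>
     Hausdorff_space X \<and> second_countable X \<and>
     (\<forall>c\<in>A. is_chart X c) \<and> (\<Union>(U, \<phi>)\<in>A. U) = topspace X \<and>
     (\<forall>(U, \<phi>)\<in>A. \<forall>(V, \<psi>)\<in>A. smooth_on (\<phi> ` (U \<inter> V)) (\<psi> \<circ> inv_into U \<phi>))"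

text \<open>The coordinate expressions of a map between two manifolds with atlases \<open>A\<close> and \<open>B\<close>, each
  paired with its domain.\<close>

definition local_reps ::
  "('a, 'e) chart set \<Rightarrow> ('b, 'f) chart set \<Rightarrow> ('a \<Rightarrow> 'b) \<Rightarrow> ('e set \<times> ('e \<Rightarrow> 'f)) set" where
  "local_reps A B f = {(\<phi> ` {x \<in> U. f x \<in> V}, \<psi> \<circ> f \<circ> inv_into U \<phi>) |U \<phi> V \<psi>.
     (U, \<phi>) \<in> A \<and> (V, \<psi>) \<in> B}"

definition smooth_map ::
  "'a topology \<Rightarrow> ('a, 'e::euclidean_space) chart set \<Rightarrow>
   'b topology \<Rightarrow> ('b, 'f::euclidean_space) chart set \<Rightarrow> ('a \<Rightarrow> 'b) \<Rightarrow> bool" where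
  "smooth_map X A Y B f \<longleftrightarrow>
     continuous_map X Y f \<and> (\<forall>(W, F)\<in>local_reps A B f. smooth_on W F)"

definition smooth_immersion ::
  "'a topology \<Rightarrow> ('a, 'e::euclidean_space) chart set \<Rightarrow>
   'b topology \<Rightarrow> ('b, 'f::euclidean_space) chart set \<Rightarrow> ('a \<Rightarrow> 'b) \<Rightarrow> bool" where
  "smooth_immersion X A Y B f \<longleftrightarrow> smooth_map X A Y B f \<and>
     (\<forall>(W, F)\<in>local_reps A B f. \<forall>x\<in>W. inj (frechet_derivative F (at x)))"


section \<open>Riemannian geometry of immersions in coordinates\<close>

text \<open>\<open>G y a b\<close> is the inner product of \<open>a\<close> and \<open>b\<close> as tangent vectors at the point with
  coordinates \<open>y\<close>.\<close>

type_synonym 'f metric_field = "'f \<Rightarrow> 'f \<Rightarrow> 'f \<Rightarrow> real"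

text \<open>The Levi-Civita connection, from the Koszul formula for constant coordinate fields.\<close>

definition christoffel :: "'f::euclidean_space metric_field \<Rightarrow> 'f \<Rightarrow> 'f \<Rightarrow> 'f \<Rightarrow> 'f" where
  "christoffel G y a b = (THE c. \<forall>d. 2 * G y c d =
     frechet_derivative (\<lambda>z. G z b d) (at y) a +
     frechet_derivative (\<lambda>z. G z a d) (at y) b -
     frechet_derivative (\<lambda>z. G z a b) (at y) d)"

text \<open>Throughout, \<open>F\<close> is a coordinate expression of the immersion and \<open>x\<close> a point of its domain.
  Tangent vectors \<open>u\<close>, \<open>v\<close> of the immersed manifold are given by their coordinates, tangent vectors
  of the ambient manifold along \<open>F\<close> by theirs.\<close>

definition tangent_space :: "('e::euclidean_space \<Rightarrow> 'f::euclidean_space) \<Rightarrow> 'e \<Rightarrow> 'f set" where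
  "tangent_space F x = range (frechet_derivative F (at x))"

definition induced_metric ::
  "'f::euclidean_space metric_field \<Rightarrow> ('e::euclidean_space \<Rightarrow> 'f) \<Rightarrow> 'e metric_field" where
  "induced_metric G F x u v =
     G (F x) (frechet_derivative F (at x) u) (frechet_derivative F (at x) v)"

definition normal_space ::
  "'f::euclidean_space metric_field \<Rightarrow> ('e::euclidean_space \<Rightarrow> 'f) \<Rightarrow> 'e \<Rightarrow> 'f set" where
  "normal_space G F x = {\<eta>. \<forall>w\<in>tangent_space F x. G (F x) \<eta> w = 0}"

definition normal_part ::
  "'f::euclidean_space metric_field \<Rightarrow> ('e::euclidean_space \<Rightarrow> 'f) \<Rightarrow> 'e \<Rightarrow> 'f \<Rightarrow> 'f" where
  "normal_part G F x w = (THE \<eta>. \<eta> \<in> normal_space G F x \<and> w - \<eta> \<in> tangent_space F x)"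

text \<open>Ambient covariant derivative in direction \<open>u\<close> of a vector field \<open>\<xi>\<close> along \<open>F\<close>.\<close>

definition covariant_derivative ::
  "'f::euclidean_space metric_field \<Rightarrow> ('e::euclidean_space \<Rightarrow> 'f) \<Rightarrow> ('e \<Rightarrow> 'f) \<Rightarrow> 'e \<Rightarrow> 'e \<Rightarrow> 'f" where
  "covariant_derivative G F \<xi> x u =
     frechet_derivative \<xi> (at x) u + christoffel G (F x) (frechet_derivative F (at x) u) (\<xi> x)"

text \<open>Being tensorial, the second fundamental form may be evaluated on constant coordinate
  fields.\<close>

definition second_fundamental_form ::
  "'f::euclidean_space metric_field \<Rightarrow> ('e::euclidean_space \<Rightarrow> 'f) \<Rightarrow> 'e \<Rightarrow> 'e \<Rightarrow> 'e \<Rightarrow> 'f" where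
  "second_fundamental_form G F x u v =
     normal_part G F x (covariant_derivative G F (\<lambda>z. frechet_derivative F (at z) v) x u)"

definition shape_operator ::
  "'f::euclidean_space metric_field \<Rightarrow> ('e::euclidean_space \<Rightarrow> 'f) \<Rightarrow> 'e \<Rightarrow> 'f \<Rightarrow> 'e \<Rightarrow> 'e" where
  "shape_operator G F x \<eta> u =
     (THE a. \<forall>v. induced_metric G F x a v = G (F x) (second_fundamental_form G F x u v) \<eta>)"

definition orthonormal_frame ::
  "'f::euclidean_space metric_field \<Rightarrow> (real^'n \<Rightarrow> 'f) \<Rightarrow> real^'n \<Rightarrow> ('n \<Rightarrow> real^'n) \<Rightarrow> bool" where
  "orthonormal_frame G F x e \<longleftrightarrow>
     (\<forall>i j. induced_metric G F x (e i) (e j) = (if i = j then 1 else 0))"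

definition mean_curvature ::
  "'f::euclidean_space metric_field \<Rightarrow> (real^'n \<Rightarrow> 'f) \<Rightarrow> real^'n \<Rightarrow> 'f" where
  "mean_curvature G F x = (THE \<zeta>. \<forall>e. orthonormal_frame G F x e \<longrightarrow>
     \<zeta> = (1 / real CARD('n)) *\<^sub>R (\<Sum>i\<in>UNIV. second_fundamental_form G F x (e i) (e i)))"

definition normal_derivative ::
  "'f::euclidean_space metric_field \<Rightarrow> ('e::euclidean_space \<Rightarrow> 'f) \<Rightarrow> ('e \<Rightarrow> 'f) \<Rightarrow> 'e \<Rightarrow> 'e \<Rightarrow> 'f" where
  "normal_derivative G F \<xi> x u = normal_part G F x (covariant_derivative G F \<xi> x u)"

text \<open>No bracket term occurs because constant coordinate fields commute.\<close>

definition normal_curvature ::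
  "'f::euclidean_space metric_field \<Rightarrow> ('e::euclidean_space \<Rightarrow> 'f) \<Rightarrow> ('e \<Rightarrow> 'f) \<Rightarrow>
   'e \<Rightarrow> 'e \<Rightarrow> 'e \<Rightarrow> 'f" where
  "normal_curvature G F \<xi> x u v =
     normal_derivative G F (\<lambda>z. normal_derivative G F \<xi> z v) x u -
     normal_derivative G F (\<lambda>z. normal_derivative G F \<xi> z u) x v"


section \<open>Complex projective space\<close>

text \<open>Points are the complex lines in \<open>\<complex>\<^sup>m\<^sup>+\<^sup>1\<close>, whose coordinates are indexed by \<open>'m option\<close> with
  \<open>CARD('m) = m\<close>.\<close>

definition cproj :: "(complex ^ 'm::finite option) set set" where
  "cproj = {vec.span {z} |z. z \<noteq> 0}"

text \<open>The quotient topology.\<close>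

definition cproj_topology :: "(complex ^ 'm::finite option) set topology" where
  "cproj_topology = topology (\<lambda>S. S \<subseteq> cproj \<and> open {z. z \<noteq> 0 \<and> vec.span {z} \<in> S})"

lemma openin_cproj_topology:
  fixes S :: "(complex ^ 'm::finite option) set set"
  shows "openin cproj_topology S \<longleftrightarrow> S \<subseteq> cproj \<and> open {z. z \<noteq> 0 \<and> vec.span {z} \<in> S}"
proof -
  have "istopology (\<lambda>S. S \<subseteq> cproj \<and> open {z::complex ^ 'm option. z \<noteq> 0 \<and> vec.span {z} \<in> S})"
    unfolding istopology_def
  proof (intro conjI allI impI)
    fix S T :: "(complex ^ 'm option) set set"
    assume "S \<subseteq> cproj \<and> open {z. z \<noteq> 0 \<and> vec.span {z} \<in> S}"
      and "T \<subseteq> cproj \<and> open {z. z \<noteq> 0 \<and> vec.span {z} \<in> T}"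
    moreover have "{z. z \<noteq> 0 \<and> vec.span {z} \<in> S \<inter> T} =
        {z. z \<noteq> 0 \<and> vec.span {z} \<in> S} \<inter> {z. z \<noteq> 0 \<and> vec.span {z} \<in> T}"
      by auto
    ultimately show "S \<inter> T \<subseteq> cproj" "open {z. z \<noteq> 0 \<and> vec.span {z} \<in> S \<inter> T}"
      by auto
  next
    fix K :: "(complex ^ 'm option) set set set"
    assume K: "\<forall>S\<in>K. S \<subseteq> cproj \<and> open {z. z \<noteq> 0 \<and> vec.span {z} \<in> S}"
    then show "\<Union>K \<subseteq> cproj" by auto
    have "{z. z \<noteq> 0 \<and> vec.span {z} \<in> \<Union>K} = (\<Union>S\<in>K. {z. z \<noteq> 0 \<and> vec.span {z} \<in> S})"
      by auto
    with K show "open {z. z \<noteq> 0 \<and> vec.span {z} \<in> \<Union>K}"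
      by auto
  qed
  then show ?thesis
    by (simp add: cproj_topology_def)
qed

text \<open>\<open>affine_index i\<close> enumerates the homogeneous coordinates other than the \<open>i\<close>-th one.\<close>

definition affine_index :: "'m option \<Rightarrow> 'm \<Rightarrow> 'm option" where
  "affine_index i j = (if Some j = i then None else Some j)"

definition affine_domain :: "'m option \<Rightarrow> (complex ^ 'm::finite option) set set" where
  "affine_domain i = {L \<in> cproj. \<exists>z\<in>L. z $ i \<noteq> 0}"

text \<open>The affine coordinates of a line are the ratios \<open>z\<^sub>k / z\<^sub>i\<close> with \<open>k \<noteq> i\<close>; they do not depend
  on the vector \<open>z\<close> chosen on the line.\<close>

definition affine_coords :: "'m option \<Rightarrow> (complex ^ 'm::finite option) set \<Rightarrow> complex ^ 'm" where
  "affine_coords i L =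
     (let z = (SOME z. z \<in> L \<and> z \<noteq> 0) in \<chi> j. z $ affine_index i j / z $ i)"

definition cproj_atlas :: "((complex ^ 'm::finite option) set, complex ^ 'm) chart set" where
  "cproj_atlas = {(affine_domain i, affine_coords i) |i. True}"

text \<open>The coordinate expression is the same in every affine chart. It is the quotient by the Hopf
  fibration of the metric of the unit sphere, so the holomorphic sectional curvature is \<open>4\<close>.\<close>

definition hermitian_product :: "complex ^ 'm \<Rightarrow> complex ^ 'm \<Rightarrow> complex" where
  "hermitian_product a b = (\<Sum>j\<in>UNIV. a $ j * cnj (b $ j))"

definition fubini_study :: "(complex ^ 'm) metric_field" where
  "fubini_study w a b =
     Re ((1 + (norm w)\<^sup>2) * hermitian_product a b - hermitian_product a w * hermitian_product w b)
       / (1 + (norm w)\<^sup>2)\<^sup>2"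

text \<open>The affine charts are holomorphic, so in each of them \<open>J\<close> is multiplication by \<open>\<i>\<close>.\<close>

definition cstruct :: "complex ^ 'm \<Rightarrow> complex ^ 'm" where
  "cstruct a = \<i> *s a"


section \<open>Submanifolds of complex projective space\<close>

text \<open>Submanifolds are immersed: \<open>f\<close> is the immersion of the manifold \<open>(X, A)\<close>. If \<open>f\<close> is the
  inclusion of a subset, embedded submanifolds are obtained.\<close>

definition cproj_submanifold ::
  "'a topology \<Rightarrow> ('a, real ^ 'n) chart set \<Rightarrow> ('a \<Rightarrow> (complex ^ 'm::finite option) set) \<Rightarrow> bool"
  where
  "cproj_submanifold X A f \<longleftrightarrow> topspace X \<noteq> {} \<and> smooth_manifold X A \<and>
     smooth_immersion X A cproj_topology cproj_atlas f"

definition holomorphic_tangent_space ::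
  "('e::euclidean_space \<Rightarrow> complex ^ 'm) \<Rightarrow> 'e \<Rightarrow> (complex ^ 'm) set" where
  "holomorphic_tangent_space F x = cstruct ` tangent_space F x \<inter> tangent_space F x"

definition CR_maximal_dim ::
  "('a, real ^ 'n) chart set \<Rightarrow> ('a \<Rightarrow> (complex ^ 'm::finite option) set) \<Rightarrow> bool" where
  "CR_maximal_dim A f \<longleftrightarrow> (\<forall>(W, F)\<in>local_reps A cproj_atlas f. \<forall>x\<in>W.
     dim (holomorphic_tangent_space F x) = CARD('n) - 1)"

definition flat_normal_connection ::
  "('a, real ^ 'n) chart set \<Rightarrow> ('a \<Rightarrow> (complex ^ 'm::finite option) set) \<Rightarrow> bool" where
  "flat_normal_connection A f \<longleftrightarrow> (\<forall>(W, F)\<in>local_reps A cproj_atlas f.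
     \<forall>W' \<xi>. open W' \<and> W' \<subseteq> W \<and> smooth_on W' \<xi> \<and>
       (\<forall>x\<in>W'. \<xi> x \<in> normal_space fubini_study F x) \<longrightarrow>
       (\<forall>x\<in>W'. \<forall>u v. normal_curvature fubini_study F \<xi> x u v = 0))"

definition totally_geodesic ::
  "('a, real ^ 'n) chart set \<Rightarrow> ('a \<Rightarrow> (complex ^ 'm::finite option) set) \<Rightarrow> bool" where
  "totally_geodesic A f \<longleftrightarrow> (\<forall>(W, F)\<in>local_reps A cproj_atlas f. \<forall>x\<in>W. \<forall>u v.
     second_fundamental_form fubini_study F x u v = 0)"

definition totally_umbilical ::
  "('a, real ^ 'n) chart set \<Rightarrow> ('a \<Rightarrow> (complex ^ 'm::finite option) set) \<Rightarrow> bool" where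
  "totally_umbilical A f \<longleftrightarrow> (\<forall>(W, F)\<in>local_reps A cproj_atlas f. \<forall>x\<in>W.
     \<forall>\<eta>\<in>normal_space fubini_study F x. \<forall>u.
       shape_operator fubini_study F x \<eta> u =
         fubini_study (F x) \<eta> (mean_curvature fubini_study F x) *\<^sub>R u)"

end

theory Submission
  imports Defs
begin

text \<open>Only the Codazzi equation is used. For an umbilical immersion the second fundamental form is
  \<open>h(Y, Z) = \<langle>Y, Z\<rangle> \<zeta>\<close> (with \<open>\<zeta> = 0\<close> in the totally geodesic case), so the normal part of
  \<open>R(X, Y)Z\<close> is \<open>\<langle>Y, Z\<rangle> \<nabla>\<^sub>X \<zeta> - \<langle>X, Z\<rangle> \<nabla>\<^sub>Y \<zeta>\<close>, which vanishes if \<open>X\<close> and \<open>Y\<close> are orthogonal to \<open>Z\<close>.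
  If the CR dimension is maximal, choose \<open>X \<noteq> 0\<close> holomorphic, \<open>Y = JX\<close>, and \<open>Z \<noteq> 0\<close> tangent and
  orthogonal to the holomorphic tangent space. Then \<open>JZ\<close> is normal, while
  \<open>R(X, JX)Z = -2 |X|\<^sup>2 JZ\<close> by the curvature formula of the Fubini--Study metric.\<close>

section \<open>Directional derivatives\<close>

text \<open>The obstacle is regularity: umbilicity supplies \<zeta> separately at each point, so
  \<nabla>\<zeta> cannot be formed directly. Instead \<zeta> is eliminated. With Y and Z constant
  coordinate fields, the field S = \<nabla>_Y Z - (\<langle>Y, Z\<rangle> / \<langle>Z, Z\<rangle>)
  \<nabla>_Z Z has no normal part, hence S = dF(c) for some coefficient field c. This c is chosen
  pointwise, yet Cramer's rule makes it differentiable. The normal part of the derivative of dF(c)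
  is once more a value of the second fundamental form, so pairing with a normal vector at the single
  point x yields the Codazzi identity there. Orthogonality and Y = JX are imposed at x only, where
  the quotient vanishes but its derivative need not; the terms that survive are symmetric in X and
  Y, because constant coordinate fields commute and the connection is torsion-free.\<close>

definition dird :: "'a::euclidean_space \<Rightarrow> ('a \<Rightarrow> 'b::euclidean_space) \<Rightarrow> 'a \<Rightarrow> 'b" where
  "dird v f x = frechet_derivative f (at x) v"

lemma has_derivative_dird: "f differentiable (at x) \<Longrightarrow> (f has_derivative (\<lambda>v. dird v f x)) (at x)"
  unfolding dird_def by (simp add: frechet_derivative_works[symmetric])

lemma dird_eqI: "(f has_derivative f') (at x) \<Longrightarrow> dird v f x = f' v"
  unfolding dird_def by (metis frechet_derivative_at)

text \<open>Functions that agree near \<open>x\<close> have the same derivatives there, so the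
  choice made by \<open>frechet_derivative\<close> coincides, even at points without a
  derivative.\<close>

lemma dird_cong:
  assumes "open W" "x \<in> W" "\<And>z. z \<in> W \<Longrightarrow> f z = g z"
  shows "dird v f x = dird v g x"
proof -
  have "(f has_derivative D) (at x) \<longleftrightarrow> (g has_derivative D) (at x)" for D
    using has_derivative_transform_within_open[of f D x UNIV W g]
      has_derivative_transform_within_open[of g D x UNIV W f] assms by auto
  then show ?thesis
    by (simp add: dird_def frechet_derivative_def)
qed

lemma smooth_on_differentiable: "smooth_on W f \<Longrightarrow> x \<in> W \<Longrightarrow> f differentiable (at x)"
  unfolding smooth_on_def by (drule spec[of _ "Suc 0"]) simp

lemma smooth_on_continuous: "smooth_on W f \<Longrightarrow> continuous_on W f"
  unfolding smooth_on_def by (drule spec[of _ 0]) simp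

lemma smooth_on_dird: "smooth_on W f \<Longrightarrow> smooth_on W (dird v f)"
  unfolding smooth_on_def dird_def[abs_def] using Ck_on.simps(2) by blast

section \<open>Symmetry of second derivatives\<close>

lemma has_real_derivative_line:
  fixes g :: "'a::euclidean_space \<Rightarrow> real"
  assumes "g differentiable (at (y + s *\<^sub>R v))"
  shows "((\<lambda>s. g (y + s *\<^sub>R v)) has_real_derivative dird v g (y + s *\<^sub>R v)) (at s)"
proof -
  have "((\<lambda>s. y + s *\<^sub>R v) has_derivative (\<lambda>t. t *\<^sub>R v)) (at s)"
    by (auto intro!: derivative_eq_intros)
  from has_derivative_compose[OF this has_derivative_dird[OF assms]]
  have "((\<lambda>s. g (y + s *\<^sub>R v)) has_derivative (\<lambda>t. dird (t *\<^sub>R v) g (y + s *\<^sub>R v))) (at s)" .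
  moreover have "dird (t *\<^sub>R v) g (y + s *\<^sub>R v) = dird v g (y + s *\<^sub>R v) * t" for t
    using linear_scale[OF has_derivative_linear[OF has_derivative_dird[OF assms]]] by simp
  ultimately show ?thesis
    by (simp add: has_field_derivative_def)
qed

text \<open>The mean value theorem is applied twice: in direction \<open>u\<close> to the difference
  of \<open>g\<close> and its translate by \<open>h v\<close>, then in direction \<open>v\<close> to
  \<open>dird u g\<close>.\<close>

lemma second_difference_mvt:
  fixes g :: "'a::euclidean_space \<Rightarrow> real"
  assumes h: "h > 0" and W: "\<And>s t. 0 \<le> s \<Longrightarrow> s \<le> h \<Longrightarrow> 0 \<le> t \<Longrightarrow> t \<le> h \<Longrightarrow> x + s *\<^sub>R u + t *\<^sub>R v \<in> W"
    and g: "\<And>y. y \<in> W \<Longrightarrow> g differentiable (at y)"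
    and gu: "\<And>y. y \<in> W \<Longrightarrow> dird u g differentiable (at y)"
  shows "\<exists>s t. 0 \<le> s \<and> s \<le> h \<and> 0 \<le> t \<and> t \<le> h \<and>
    g (x + h *\<^sub>R u + h *\<^sub>R v) - g (x + h *\<^sub>R u) - g (x + h *\<^sub>R v) + g x =
      h * (h * dird v (dird u g) (x + s *\<^sub>R u + t *\<^sub>R v))"
proof -
  have *: "((\<lambda>s. g (x + c + s *\<^sub>R u) - g (x + s *\<^sub>R u)) has_real_derivative
      dird u g (x + c + s *\<^sub>R u) - dird u g (x + s *\<^sub>R u)) (at s)"
    if "0 \<le> s" "s \<le> h" "c = h *\<^sub>R v" for s c
    using W[OF that(1,2), of 0] W[OF that(1,2), of h] h that(3)
    by (intro DERIV_diff has_real_derivative_line g) (simp_all add: ac_simps)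
  obtain s where s: "0 < s" "s < h" and eq1:
    "g (x + h *\<^sub>R v + h *\<^sub>R u) - g (x + h *\<^sub>R u) - (g (x + h *\<^sub>R v + 0 *\<^sub>R u) - g (x + 0 *\<^sub>R u))
      = (h - 0) * (dird u g (x + h *\<^sub>R v + s *\<^sub>R u) - dird u g (x + s *\<^sub>R u))"
    using MVT2[OF h *[OF _ _ refl]] by blast
  have **: "((\<lambda>t. dird u g (x + s *\<^sub>R u + t *\<^sub>R v)) has_real_derivative
      dird v (dird u g) (x + s *\<^sub>R u + t *\<^sub>R v)) (at t)" if "0 \<le> t" "t \<le> h" for t
    using W[of s t] s that by (intro has_real_derivative_line gu) simp
  obtain t where "0 < t" "t < h" and
    "dird u g (x + s *\<^sub>R u + h *\<^sub>R v) - dird u g (x + s *\<^sub>R u + 0 *\<^sub>R v)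
      = (h - 0) * dird v (dird u g) (x + s *\<^sub>R u + t *\<^sub>R v)"
    using MVT2[OF h **] by blast
  with s eq1 show ?thesis
    by (intro exI[of _ s] exI[of _ t]) (simp add: ac_simps)
qed

text \<open>The second difference is symmetric in \<open>u\<close> and \<open>v\<close>, and divided
  by the square of \<open>h\<close> it is a value near \<open>x\<close> of either mixed derivative.
  By continuity the two cannot differ at \<open>x\<close>.\<close>

lemma dird_commute_real:
  fixes g :: "'a::euclidean_space \<Rightarrow> real"
  assumes W: "open W" "x \<in> W" and g: "smooth_on W g"
  shows "dird v (dird u g) x = dird u (dird v g) x"
proof (rule ccontr)
  assume ne: "dird v (dird u g) x \<noteq> dird u (dird v g) x"
  define P where "P = dird v (dird u g)"
  define Q where "Q = dird u (dird v g)"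
  define e where "e = \<bar>P x - Q x\<bar> / 2"
  have e: "e > 0" using ne by (simp add: e_def P_def Q_def)
  have "continuous (at x) P" "continuous (at x) Q"
    unfolding P_def Q_def
    using W(2) continuous_on_eq_continuous_at[OF W(1)] smooth_on_continuous[OF smooth_on_dird[OF smooth_on_dird[OF g]]]
    by auto
  then obtain d1 d2 where d: "d1 > 0" "d2 > 0" and dP: "\<And>y. dist y x < d1 \<Longrightarrow> dist (P y) (P x) < e"
      and dQ: "\<And>y. dist y x < d2 \<Longrightarrow> dist (Q y) (Q x) < e"
    using e unfolding continuous_at_eps_delta by blast
  obtain d3 where d3: "d3 > 0" "ball x d3 \<subseteq> W"
    using W by (rule openE)
  define r where "r = Min {d1, d2, d3}"
  have r: "r > 0" "r \<le> d1" "r \<le> d2" "r \<le> d3" using d d3 by (auto simp: r_def)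
  \<comment> \<open>Keeps the parallelogram spanned by \<open>h u\<close> and \<open>h v\<close>
    inside the ball of radius \<open>r\<close>; the summand 1 covers \<open>u = v = 0\<close> and
    makes the bound strict.\<close>
  define h where "h = r / (1 + norm u + norm v)"
  have n: "1 + norm u + norm v > 0" by (smt (verit) norm_ge_zero)
  then have h: "h > 0" using r by (simp add: h_def)
  have near: "dist (x + s *\<^sub>R u + t *\<^sub>R v) x < r" if "0 \<le> s" "s \<le> h" "0 \<le> t" "t \<le> h" for s t
  proof -
    have "norm (s *\<^sub>R u + t *\<^sub>R v) \<le> s * norm u + t * norm v"
      using norm_triangle_ineq[of "s *\<^sub>R u" "t *\<^sub>R v"] that by simp
    also have "\<dots> \<le> h * norm u + h * norm v"
      using that by (intro add_mono mult_right_mono) auto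
    also have "\<dots> < h * (1 + norm u + norm v)"
      using h by (simp add: algebra_simps)
    also have "\<dots> = r" using n by (simp add: h_def)
    finally show ?thesis by (simp add: dist_norm add.assoc)
  qed
  have inW: "x + s *\<^sub>R u + t *\<^sub>R v \<in> W" if "0 \<le> s" "s \<le> h" "0 \<le> t" "t \<le> h" for s t
    using near[OF that] r d3 by (auto simp: dist_commute)
  note diff = smooth_on_differentiable[OF g] smooth_on_differentiable[OF smooth_on_dird[OF g]]
  obtain s t where 1: "0 \<le> s" "s \<le> h" "0 \<le> t" "t \<le> h"
      "g (x + h *\<^sub>R u + h *\<^sub>R v) - g (x + h *\<^sub>R u) - g (x + h *\<^sub>R v) + g x
      = h * (h * P (x + s *\<^sub>R u + t *\<^sub>R v))"
    using second_difference_mvt[OF h inW diff] unfolding P_def by blast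
  have "x + s *\<^sub>R v + t *\<^sub>R u \<in> W" if "0 \<le> s" "s \<le> h" "0 \<le> t" "t \<le> h" for s t
    using inW[of t s] that by (simp add: ac_simps)
  from second_difference_mvt[OF h this diff]
  obtain s' t' where 2: "0 \<le> s'" "s' \<le> h" "0 \<le> t'" "t' \<le> h"
      "g (x + h *\<^sub>R v + h *\<^sub>R u) - g (x + h *\<^sub>R v) - g (x + h *\<^sub>R u) + g x
      = h * (h * Q (x + s' *\<^sub>R v + t' *\<^sub>R u))"
    unfolding Q_def by blast
  \<comment> \<open>Both expansions are of the same second difference.\<close>
  have "P (x + s *\<^sub>R u + t *\<^sub>R v) = Q (x + t' *\<^sub>R u + s' *\<^sub>R v)"
    using 1(5) 2(5) h by (simp add: algebra_simps)
  moreover have "\<bar>P (x + s *\<^sub>R u + t *\<^sub>R v) - P x\<bar> < \<bar>P x - Q x\<bar> / 2"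
    using dP[of "x + s *\<^sub>R u + t *\<^sub>R v"] near[of s t] 1 r by (simp add: e_def dist_real_def)
  moreover have "\<bar>Q (x + t' *\<^sub>R u + s' *\<^sub>R v) - Q x\<bar> < \<bar>P x - Q x\<bar> / 2"
    using dQ[of "x + t' *\<^sub>R u + s' *\<^sub>R v"] near[of t' s'] 2 r by (simp add: e_def dist_real_def)
  ultimately show False
    by (smt (verit) field_sum_of_halves)
qed

lemma dird_inner:
  "f differentiable (at x) \<Longrightarrow> dird v (\<lambda>z. f z \<bullet> i) x = dird v f x \<bullet> i"
  by (rule dird_eqI) (rule has_derivative_inner_left, rule has_derivative_dird)

text \<open>The derivative of the component is the component of the derivative only where
  \<open>f\<close> is differentiable, so \<open>Ck_on\<close> is first shown to depend on the values
  on the open set \<open>W\<close> alone. Reduces symmetry of second derivatives to real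
  functions.\<close>

lemma smooth_on_inner:
  assumes "open W" "smooth_on W f"
  shows "smooth_on W (\<lambda>z. f z \<bullet> i)"
proof -
  have cong: "Ck_on k W f \<Longrightarrow> (\<And>z. z \<in> W \<Longrightarrow> f z = g z) \<Longrightarrow> Ck_on k W g" for k and f g :: "'a \<Rightarrow> real"
  proof (induction k arbitrary: f g)
    case 0
    then show ?case using continuous_on_cong[of W W f g] by simp
  next
    case (Suc k)
    have "g differentiable (at z)" if "z \<in> W" for z
    proof -
      have "(f has_derivative (\<lambda>v. dird v f z)) (at z)"
        using Suc.prems(1) that by (intro has_derivative_dird) simp
      then have "(g has_derivative (\<lambda>v. dird v f z)) (at z)"
        by (rule has_derivative_transform_within_open) (use assms(1) that Suc.prems(2) in auto)
      then show ?thesis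
        by (auto simp: differentiable_def)
    qed
    moreover have "Ck_on k W (dird v g)" for v
    proof (rule Suc.IH)
      show "Ck_on k W (dird v f)"
        using Suc.prems(1) by (simp add: dird_def[abs_def])
      show "dird v f z = dird v g z" if "z \<in> W" for z
        by (rule dird_cong[OF assms(1) that Suc.prems(2)])
    qed
    ultimately show ?case
      by (simp add: dird_def[abs_def])
  qed
  have "Ck_on k W f \<Longrightarrow> Ck_on k W (\<lambda>z. f z \<bullet> i)" for k and f :: "'a \<Rightarrow> 'b"
  proof (induction k arbitrary: f)
    case 0
    then show ?case by (auto intro: continuous_intros)
  next
    case (Suc k)
    have "Ck_on k W (dird v (\<lambda>z. f z \<bullet> i))" for v
    proof (rule cong)
      show "Ck_on k W (\<lambda>z. dird v f z \<bullet> i)"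
        using Suc by (simp add: dird_def[abs_def])
      show "dird v f z \<bullet> i = dird v (\<lambda>z. f z \<bullet> i) z" if "z \<in> W" for z
        using Suc.prems that by (simp add: dird_inner)
    qed
    with Suc.prems show ?case
      by (simp add: dird_def[abs_def])
  qed
  with assms(2) show ?thesis
    by (simp add: smooth_on_def)
qed

lemma dird_commute:
  assumes W: "open W" "x \<in> W" and f: "smooth_on W f"
  shows "dird v (dird u f) x = dird u (dird v f) x"
proof (rule euclidean_eqI)
  fix i :: 'b assume "i \<in> Basis"
  have "dird v (dird u f) x \<bullet> i = dird v (dird u (\<lambda>z. f z \<bullet> i)) x" for u v
  proof -
    have "dird v (dird u f) x \<bullet> i = dird v (\<lambda>z. dird u f z \<bullet> i) x"
      using smooth_on_differentiable[OF smooth_on_dird[OF f] W(2)] by (simp add: dird_inner)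
    also have "\<dots> = dird v (dird u (\<lambda>z. f z \<bullet> i)) x"
      by (rule dird_cong[OF W]) (simp add: dird_inner smooth_on_differentiable[OF f])
    finally show ?thesis .
  qed
  with dird_commute_real[OF W smooth_on_inner[OF W(1) f]]
  show "dird v (dird u f) x \<bullet> i = dird u (dird v f) x \<bullet> i"
    by simp
qed

section \<open>Linear algebra\<close>

lemma differentiable_det:
  fixes M :: "'e::real_normed_vector \<Rightarrow> real^'n^'n"
  assumes "\<And>i j. (\<lambda>z. M z $ i $ j) differentiable (at x)"
  shows "(\<lambda>z. det (M z)) differentiable (at x)"
proof -
  have "(\<lambda>z. \<Prod>i\<in>UNIV. M z $ i $ p i) differentiable (at x)" for p
  proof -
    have "\<forall>i. \<exists>D. ((\<lambda>z. M z $ i $ p i) has_derivative D) (at x)"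
      using assms by (simp add: differentiable_def)
    from choice[OF this] obtain D where D: "\<forall>i. ((\<lambda>z. M z $ i $ p i) has_derivative D i) (at x)" ..
    show ?thesis
      using has_derivative_prod[of UNIV "\<lambda>i z. M z $ i $ p i" D x UNIV] D
      by (auto simp: differentiable_def)
  qed
  then show ?thesis
    unfolding det_def by (intro differentiable_sum differentiable_mult differentiable_const) auto
qed

text \<open>Composing with a left inverse of \<open>A x\<close> gives a square system for
  \<open>c z\<close> whose matrix is the identity at \<open>x\<close>, hence invertible nearby;
  Cramer's rule then writes \<open>c\<close> as a quotient of determinants. The lemma gives
  regularity to coefficients that were chosen pointwise.\<close>

lemma differentiable_linear_preimage:
  fixes A :: "'e::euclidean_space \<Rightarrow> real^'n \<Rightarrow> 'f::euclidean_space"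
  assumes W: "open W" "x \<in> W" and lin: "\<And>z. z \<in> W \<Longrightarrow> linear (A z)"
    and A: "\<And>v. (\<lambda>z. A z v) differentiable (at x)" and "inj (A x)"
    and c: "(\<lambda>z. A z (c z)) differentiable (at x)"
  shows "c differentiable (at x)"
proof -
  obtain L where L: "linear L" "L \<circ> A x = id"
    using linear_injective_left_inverse[OF lin[OF W(2)] \<open>inj (A x)\<close>] by blast
  define M where "M = (\<lambda>z. matrix (L \<circ> A z))"
  define b where "b = (\<lambda>z. L (A z (c z)))"
  have L': "bounded_linear L"
    using L(1) by (simp add: linear_conv_bounded_linear)
  have diffL: "(\<lambda>z. L (f z) $ i) differentiable (at x)" if "f differentiable (at x)" for f i
    using that bounded_linear.has_derivative[OF bounded_linear_compose[OF bounded_linear_vec_nth L']]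
    unfolding differentiable_def by blast
  have M: "(\<lambda>z. M z $ i $ j) differentiable (at x)" for i j
    using diffL[OF A] by (simp add: M_def matrix_def)
  have b: "(\<lambda>z. b z $ i) differentiable (at x)" for i
    unfolding b_def by (rule diffL[OF c])
  have dM: "(\<lambda>z. det (M z)) differentiable (at x)"
    by (rule differentiable_det[OF M])
  have dx: "det (M x) \<noteq> 0"
    using L(2) by (simp add: M_def matrix_id)
  \<comment> \<open>Cramer's formula for the solution of \<open>M z *v c z = b z\<close>.\<close>
  define q where "q = (\<lambda>z. \<chi> k. det (\<chi> i j. if j = k then b z $ i else M z $ i $ j) / det (M z))"
  have q: "c z = q z" if "z \<in> W" "det (M z) \<noteq> 0" for z
  proof -
    have "M z *v c z = b z"
      unfolding M_def b_def
      using fun_cong[OF matrix_vector_mul(2)[OF linear_compose[OF lin[OF that(1)] L(1)]], of "c z"] by simp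
    then show ?thesis
      using cramer[OF that(2)] by (simp add: q_def)
  qed
  have "(\<lambda>z. q z \<bullet> e) differentiable (at x)" if "e \<in> Basis" for e
  proof -
    obtain k where "e = axis k 1"
      using \<open>e \<in> Basis\<close> by (auto simp: Basis_vec_def)
    then have "(\<lambda>z. q z \<bullet> e) = (\<lambda>z. det (\<chi> i j. if j = k then b z $ i else M z $ i $ j) / det (M z))"
      by (simp add: q_def inner_axis)
    moreover have "\<dots> differentiable (at x)"
    proof (intro differentiable_divide[OF differentiable_det dM dx])
      show "(\<lambda>z. (\<chi> i j. if j = k then b z $ i else M z $ i $ j) $ i $ j) differentiable (at x)" for i j
        using M b by (cases "j = k") auto
    qed
    ultimately show ?thesis by simp
  qed
  then have "q differentiable (at x)"
    using differentiable_componentwise_within[of q x UNIV] by simp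
  then obtain q' where "(q has_derivative q') (at x)"
    by (auto simp: differentiable_def)
  moreover have "\<forall>\<^sub>F z in at x. q z = c z"
  proof -
    have "((\<lambda>z. det (M z)) \<longlongrightarrow> det (M x)) (at x)"
      using differentiable_imp_continuous_within[OF dM] by (simp add: continuous_within)
    then have "\<forall>\<^sub>F z in at x. det (M z) \<noteq> 0"
      using dx tendsto_imp_eventually_ne by blast
    moreover have "\<forall>\<^sub>F z in at x. z \<in> W"
      using W by (simp add: eventually_at_in_open')
    ultimately show ?thesis
      by eventually_elim (simp add: q)
  qed
  ultimately have "(c has_derivative q') (at x)"
    by (rule has_derivative_transform_eventually) (simp_all add: q W(2) dx)
  then show ?thesis
    by (auto simp: differentiable_def)
qed

text \<open>Gram--Schmidt along a finite spanning set. A general form \<open>B\<close> is required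
  because the metric at a point differs from the inner product of the type.\<close>

lemma orthogonal_decomposition_form:
  fixes B :: "'a::euclidean_space \<Rightarrow> 'a \<Rightarrow> real"
  assumes "bilinear B" and pos: "\<And>a. a \<noteq> 0 \<Longrightarrow> B a a > 0" and "subspace T"
  shows "\<exists>\<eta>. (\<forall>t\<in>T. B \<eta> t = 0) \<and> w - \<eta> \<in> T"
proof -
  have left: "linear (\<lambda>a. B a t)" and right: "linear (B a)" for a t
    using \<open>bilinear B\<close> by (auto simp: bilinear_def)
  have ex: "\<exists>\<eta>. (\<forall>t\<in>span S. B \<eta> t = 0) \<and> w - \<eta> \<in> span S" if "finite S" for S w
    using that
  proof (induction S arbitrary: w)
    case empty
    show ?case by (rule exI[of _ w]) (simp add: linear_0[OF right])
  next
    case (insert s S)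
    obtain e where e: "\<forall>t\<in>span S. B e t = 0" "s - e \<in> span S"
      using insert.IH by blast
    obtain y where y: "\<forall>t\<in>span S. B y t = 0" "w - y \<in> span S"
      using insert.IH by blast
    \<comment> \<open>\<open>e\<close> is the part of \<open>s\<close> orthogonal to
      \<open>span S\<close>. If \<open>s\<close> already lies in \<open>span S\<close>, then
      \<open>e = 0\<close>, the correction vanishes and \<open>y\<close> serves.\<close>
    define \<eta> where "\<eta> = y - (B y e / B e e) *\<^sub>R e"
    have "B \<eta> t = 0" if "t \<in> span (insert s S)" for t
    proof -
      obtain k where k: "t - k *\<^sub>R s \<in> span S"
        using \<open>t \<in> span (insert s S)\<close> unfolding span_breakdown_eq ..
      have S: "B \<eta> r = 0" if "r \<in> span S" for r
        using that e y by (simp add: \<eta>_def linear_diff[OF left] linear_scale[OF left])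
      have "B \<eta> e = 0"
        using pos[of e] by (cases "e = 0") (simp_all add: \<eta>_def linear_diff[OF left] linear_scale[OF left] linear_0[OF right])
      then have "B \<eta> s = 0"
        using S[OF e(2)] by (simp add: linear_diff[OF right])
      then show ?thesis
        using S[OF k] by (simp add: linear_diff[OF right] linear_scale[OF right])
    qed
    moreover have "w - \<eta> \<in> span (insert s S)"
    proof -
      have "s \<in> span (insert s S)" "s - e \<in> span (insert s S)" "w - y \<in> span (insert s S)"
        using subsetD[OF span_mono[OF subset_insertI[of S s]]] e(2) y(2) span_base[of s "insert s S"]
        by simp_all
      then have "(w - y) + (B y e / B e e) *\<^sub>R (s - (s - e)) \<in> span (insert s S)"
        using span_add[OF _ span_scale[OF span_diff], of "w - y" "insert s S" s "s - e"] by simp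
      moreover have "(w - y) + (B y e / B e e) *\<^sub>R (s - (s - e)) = w - \<eta>"
        by (simp add: \<eta>_def)
      ultimately show ?thesis
        by (simp only:)
    qed
    ultimately show ?case by blast
  qed
  obtain S where S: "S \<subseteq> T" "independent S" "T \<subseteq> span S"
    by (rule basis_exists)
  then have "span S = T"
    using span_minimal[OF S(1) \<open>subspace T\<close>] by (intro equalityI)
  with ex[OF independent_imp_finite[OF S(2)]] show ?thesis
    by simp
qed

text \<open>The Gram map \<open>\<Phi>\<close>, which turns \<open>B a\<close> into the ordinary
  inner product, is injective by positivity and so surjective by dimension. This makes the
  description in \<open>shape_operator\<close> well defined.\<close>

lemma Riesz_form:
  fixes B :: "'a::euclidean_space \<Rightarrow> 'a \<Rightarrow> real"
  assumes "bilinear B" and pos: "\<And>a. a \<noteq> 0 \<Longrightarrow> B a a > 0" and "linear f"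
  shows "\<exists>!a. \<forall>v. B a v = f v"
proof -
  have left: "linear (\<lambda>a. B a t)" and right: "linear (B a)" for a t
    using \<open>bilinear B\<close> by (auto simp: bilinear_def)
  have uniq: "a = a'" if "\<forall>v. B a v = f v" "\<forall>v. B a' v = f v" for a a'
  proof -
    have "B (a - a') (a - a') = 0"
      using that by (simp add: linear_diff[OF left])
    then show ?thesis
      using pos[of "a - a'"] by force
  qed
  define \<Phi> where "\<Phi> = (\<lambda>a. \<Sum>b\<in>Basis. B a b *\<^sub>R b)"
  have \<Phi>: "\<Phi> a \<bullet> v = B a v" for a v
  proof -
    have "B a v = B a (\<Sum>b\<in>Basis. (v \<bullet> b) *\<^sub>R b)"
      by (simp add: euclidean_representation)
    also have "\<dots> = \<Phi> a \<bullet> v"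
      by (simp add: \<Phi>_def linear_sum[OF right] linear_scale[OF right] inner_sum_left
          inner_commute[of v] mult.commute del: euclidean_representation)
    finally show ?thesis ..
  qed
  have lin: "linear \<Phi>"
    by (rule linearI; rule vector_eq_ldot[THEN iffD1])
      (simp_all add: inner_commute[of _ "\<Phi> _"] \<Phi> inner_add_left linear_add[OF left] linear_scale[OF left] inner_right_distrib)
  have "inj \<Phi>"
  proof (rule linear_injective_0[OF lin, THEN iffD2], intro allI impI)
    fix a assume "\<Phi> a = 0"
    then have "B a a = 0" using \<Phi>[of a a] by simp
    then show "a = 0" using pos[of a] by force
  qed
  then obtain a where a: "\<Phi> a = (\<Sum>b\<in>Basis. f b *\<^sub>R b)"
    using linear_inj_imp_surj[OF lin] by (metis surjD)
  have "B a v = f v" for v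
  proof -
    have "B a v = (\<Sum>b\<in>Basis. f b *\<^sub>R b) \<bullet> v"
      using a \<Phi>[of a v] by simp
    also have "\<dots> = f (\<Sum>b\<in>Basis. (v \<bullet> b) *\<^sub>R b)"
      by (simp add: linear_sum[OF \<open>linear f\<close>] linear_scale[OF \<open>linear f\<close>] inner_sum_left
          inner_commute[of v] mult.commute del: euclidean_representation)
    finally show ?thesis by (simp add: euclidean_representation)
  qed
  then show ?thesis
    using uniq by blast
qed

section \<open>The Fubini--Study metric\<close>

lemma norm_vector_scalar_mult: "norm ((c::complex) *s (a::complex^'m::finite)) = norm c * norm a"
  by (simp add: norm_vec_def norm_mult L2_set_right_distrib[symmetric])

lemma bounded_bilinear_vector_scalar_mult:
  "bounded_bilinear (\<lambda>(c::complex) (a::complex^'m::finite). c *s a)"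
proof (unfold_locales, goal_cases)
  case 5
  show ?case
    by (rule exI[of _ 1]) (simp add: norm_vector_scalar_mult)
qed (simp_all add: vec_eq_iff algebra_simps)

lemma scaleR_eq_vector_scalar_mult: "r *\<^sub>R (a::complex^'m) = of_real r *s a"
  by (simp add: vec_eq_iff scaleR_conv_of_real[where 'a=complex])

lemma hermitian_product_add_left: "hermitian_product (a + b) c = hermitian_product a c + hermitian_product b c"
  and hermitian_product_add_right: "hermitian_product c (a + b) = hermitian_product c a + hermitian_product c b"
  and hermitian_product_scale_left: "hermitian_product (k *s a) c = k * hermitian_product a c"
  and hermitian_product_scale_right: "hermitian_product c (k *s a) = cnj k * hermitian_product c a"
  and hermitian_product_scaleR_left: "hermitian_product (r *\<^sub>R a) c = r * hermitian_product a c"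
  and hermitian_product_scaleR_right: "hermitian_product c (r *\<^sub>R a) = r * hermitian_product c a"
  by (simp_all add: hermitian_product_def algebra_simps sum.distrib sum_distrib_left
      scaleR_eq_vector_scalar_mult)

lemma cnj_hermitian_product: "cnj (hermitian_product a b) = hermitian_product b a"
  by (simp add: hermitian_product_def mult.commute)

lemma Re_hermitian_product: "Re (hermitian_product a b) = a \<bullet> b"
  by (simp add: hermitian_product_def inner_vec_def inner_complex_def)

lemma hermitian_product_self: "hermitian_product a a = of_real ((norm a)\<^sup>2)"
proof (rule complex_eqI)
  show "Re (hermitian_product a a) = Re (of_real ((norm a)\<^sup>2))"
    by (simp add: Re_hermitian_product dot_square_norm)
  show "Im (hermitian_product a a) = Im (of_real ((norm a)\<^sup>2))"
    using arg_cong[OF cnj_hermitian_product[of a a], of Im] by simp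
qed

text \<open>A unit complex factor on \<open>a\<close> makes the product real and nonnegative and
  preserves \<open>norm a\<close>; the real inequality then applies.\<close>

lemma hermitian_product_Cauchy_Schwarz: "cmod (hermitian_product a b) \<le> norm a * norm b"
proof (cases "hermitian_product a b = 0")
  case False
  define c where "c = cnj (sgn (hermitian_product a b))"
  have "c * hermitian_product a b = of_real (cmod (hermitian_product a b))"
    using complex_norm_square[of "hermitian_product a b"] False
    by (simp add: c_def sgn_eq field_simps power2_eq_square)
  then have "cmod (hermitian_product a b) = (c *s a) \<bullet> b"
    unfolding Re_hermitian_product[symmetric] hermitian_product_scale_left by simp
  also have "\<dots> \<le> norm (c *s a) * norm b"
    by (rule norm_cauchy_schwarz)
  also have "norm (c *s a) = norm a"
    using False by (simp add: norm_vector_scalar_mult c_def norm_sgn)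
  finally show ?thesis .
qed simp

lemma bounded_bilinear_hermitian_product: "bounded_bilinear (hermitian_product :: complex^'m::finite \<Rightarrow> _)"
proof (unfold_locales, goal_cases)
  case 5
  show ?case
    using hermitian_product_Cauchy_Schwarz by (intro exI[of _ 1]) auto
qed (simp_all add: hermitian_product_add_left hermitian_product_add_right
      hermitian_product_scaleR_left hermitian_product_scaleR_right,
    simp_all add: scaleR_conv_of_real)

text \<open>The Hermitian form with real part \<open>fubini_study\<close>, antilinear in its last
  argument. Everything is expressed through \<open>hermitian_product\<close>, so that conjugation
  and differentiation stay algebraic.\<close>

definition fs_hermitian :: "complex^'m::finite \<Rightarrow> complex^'m \<Rightarrow> complex^'m \<Rightarrow> complex" where
  "fs_hermitian w a b = hermitian_product a b / (1 + hermitian_product w w)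
     - hermitian_product a w * hermitian_product w b / (1 + hermitian_product w w)\<^sup>2"

lemma one_plus_hermitian_product_self_neq_0: "1 + hermitian_product w w \<noteq> 0"
  unfolding hermitian_product_self
proof
  assume "1 + complex_of_real ((norm w)\<^sup>2) = 0"
  then have "Re (1 + complex_of_real ((norm w)\<^sup>2)) = 0"
    by simp
  then show False
    by (simp add: add_nonneg_eq_0_iff)
qed

lemma fubini_study_eq_Re: "fubini_study w a b = Re (fs_hermitian w a b)"
proof -
  let ?r = "1 + (norm w)\<^sup>2"
  have r: "1 + hermitian_product w w = of_real ?r"
    by (simp add: hermitian_product_self)
  have "?r \<noteq> 0" by (smt (verit) zero_le_power2)
  then have "of_real ?r \<noteq> (0::complex)"
    using of_real_eq_0_iff by blast
  then have "fs_hermitian w a b = (of_real ?r * hermitian_product a b - hermitian_product a w * hermitian_product w b)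
       / of_real (?r\<^sup>2)"
    unfolding fs_hermitian_def r of_real_power by (simp del: of_real_add add: diff_divide_distrib power2_eq_square)
  then show ?thesis
    unfolding fubini_study_def by (simp add: Re_divide_of_real del: of_real_add of_real_power)
qed

lemma fs_hermitian_add_left: "fs_hermitian w (a + b) c = fs_hermitian w a c + fs_hermitian w b c"
  and fs_hermitian_add_right: "fs_hermitian w c (a + b) = fs_hermitian w c a + fs_hermitian w c b"
  and fs_hermitian_scale_left: "fs_hermitian w (k *s a) c = k * fs_hermitian w a c"
  and fs_hermitian_scale_right: "fs_hermitian w c (k *s a) = cnj k * fs_hermitian w c a"
  and fs_hermitian_scaleR_left: "fs_hermitian w (r *\<^sub>R a) c = r * fs_hermitian w a c"
  and fs_hermitian_scaleR_right: "fs_hermitian w c (r *\<^sub>R a) = r * fs_hermitian w c a"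
  by (simp_all add: fs_hermitian_def hermitian_product_add_left hermitian_product_add_right
      hermitian_product_scaleR_left hermitian_product_scaleR_right
      hermitian_product_scale_left hermitian_product_scale_right algebra_simps add_divide_distrib)

lemma cnj_fs_hermitian: "cnj (fs_hermitian w a b) = fs_hermitian w b a"
  by (simp add: fs_hermitian_def cnj_hermitian_product mult.commute)

lemma fubini_study_commute: "fubini_study w a b = fubini_study w b a"
  unfolding fubini_study_eq_Re cnj_fs_hermitian[of w b a, symmetric] by simp

lemma bilinear_fubini_study: "bilinear (fubini_study w)"
  unfolding bilinear_def fubini_study_eq_Re
  by (auto intro!: linearI simp: fs_hermitian_add_left fs_hermitian_add_right
      fs_hermitian_scaleR_left fs_hermitian_scaleR_right)

text \<open>By Cauchy--Schwarz the numerator is at least the square of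
  \<open>norm a\<close>.\<close>

lemma fubini_study_pos: assumes "a \<noteq> 0" shows "fubini_study w a a > 0"
proof -
  have "hermitian_product a w * hermitian_product w a = of_real ((cmod (hermitian_product a w))\<^sup>2)"
    by (metis cnj_hermitian_product complex_norm_square)
  then have "fubini_study w a a = ((1 + (norm w)\<^sup>2) * (norm a)\<^sup>2 - (cmod (hermitian_product a w))\<^sup>2) / (1 + (norm w)\<^sup>2)\<^sup>2"
    unfolding fubini_study_def hermitian_product_self by simp
  moreover have "0 < (norm a)\<^sup>2"
    using assms by simp
  moreover have "(cmod (hermitian_product a w))\<^sup>2 \<le> (norm a)\<^sup>2 * (norm w)\<^sup>2"
    by (metis hermitian_product_Cauchy_Schwarz norm_ge_zero power_mono power_mult_distrib)
  then have "0 < (1 + (norm w)\<^sup>2) * (norm a)\<^sup>2 - (cmod (hermitian_product a w))\<^sup>2"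
    using \<open>0 < (norm a)\<^sup>2\<close>
    by (simp only: distrib_right mult_1_left mult.commute[of "(norm w)\<^sup>2"])
  moreover have "1 + (norm w)\<^sup>2 > 0"
    by (simp add: add_pos_nonneg)
  ultimately show ?thesis
    by simp
qed

text \<open>The value on \<open>a\<close> of the (1,0)-form \<partial> log (1 + |w|^2), the
  differential of the Kaehler potential.\<close>

definition fs_form :: "complex^'m::finite \<Rightarrow> complex^'m \<Rightarrow> complex" where
  "fs_form w a = hermitian_product a w / (1 + hermitian_product w w)"

text \<open>The Levi-Civita connection of a Kaehler metric has complex bilinear Christoffel symbols
  in holomorphic coordinates; these are the ones of the potential log (1 + |w|^2).\<close>

definition fs_christoffel :: "complex^'m::finite \<Rightarrow> complex^'m \<Rightarrow> complex^'m \<Rightarrow> complex^'m" where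
  "fs_christoffel w a b = - (fs_form w a *s b + fs_form w b *s a)"

lemma fs_christoffel_commute: "fs_christoffel w a b = fs_christoffel w b a"
  by (simp add: fs_christoffel_def add.commute)

text \<open>Compatibility of the connection with the metric, in Hermitian form and along a map
  \<open>F\<close>.\<close>

lemma has_derivative_fs_hermitian:
  fixes F a b :: "'e::real_normed_vector \<Rightarrow> complex^'m::finite"
  assumes F: "(F has_derivative F') (at x)" and a: "(a has_derivative a') (at x)"
    and b: "(b has_derivative b') (at x)"
  shows "((\<lambda>z. fs_hermitian (F z) (a z) (b z)) has_derivative
    (\<lambda>u. fs_hermitian (F x) (a' u + fs_christoffel (F x) (F' u) (a x)) (b x)
       + fs_hermitian (F x) (a x) (b' u + fs_christoffel (F x) (F' u) (b x)))) (at x)"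
proof -
  note D = bounded_bilinear.FDERIV[OF bounded_bilinear_hermitian_product]
  define p where "p = (\<lambda>z. inverse (1 + hermitian_product (F z) (F z)))"
  have r: "1 + hermitian_product (F x) (F x) \<noteq> 0"
    by (rule one_plus_hermitian_product_self_neq_0)
  have p: "(p has_derivative
      (\<lambda>u. - (p x * (hermitian_product (F x) (F' u) + hermitian_product (F' u) (F x)) * p x))) (at x)"
    unfolding p_def by (rule has_derivative_eq_rhs, (rule derivative_intros D F r)+) simp
  have "((\<lambda>z. p z * hermitian_product (a z) (b z)
      - p z * p z * (hermitian_product (a z) (F z) * hermitian_product (F z) (b z))) has_derivative
    (\<lambda>u. fs_hermitian (F x) (a' u + fs_christoffel (F x) (F' u) (a x)) (b x)
       + fs_hermitian (F x) (a x) (b' u + fs_christoffel (F x) (F' u) (b x)))) (at x)"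
  proof (rule has_derivative_eq_rhs)
    show "((\<lambda>z. p z * hermitian_product (a z) (b z)
        - p z * p z * (hermitian_product (a z) (F z) * hermitian_product (F z) (b z))) has_derivative
      (\<lambda>u. (p x * (hermitian_product (a x) (b' u) + hermitian_product (a' u) (b x))
          + - (p x * (hermitian_product (F x) (F' u) + hermitian_product (F' u) (F x)) * p x)
            * hermitian_product (a x) (b x))
        - (p x * p x * (hermitian_product (a x) (F x)
              * (hermitian_product (F x) (b' u) + hermitian_product (F' u) (b x))
            + (hermitian_product (a x) (F' u) + hermitian_product (a' u) (F x))
              * hermitian_product (F x) (b x))
          + (p x * - (p x * (hermitian_product (F x) (F' u) + hermitian_product (F' u) (F x)) * p x)
            + - (p x * (hermitian_product (F x) (F' u) + hermitian_product (F' u) (F x)) * p x) * p x)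
            * (hermitian_product (a x) (F x) * hermitian_product (F x) (b x))))) (at x)"
      by (rule derivative_intros D F a b p)+
    have c: "cnj (p x) = p x"
      by (simp add: p_def cnj_hermitian_product)
    have h: "fs_hermitian (F x) c d = p x * hermitian_product c d
      - p x * p x * (hermitian_product c (F x) * hermitian_product (F x) d)" for c d
      by (simp add: fs_hermitian_def p_def divide_inverse power2_eq_square)
    have g: "fs_christoffel (F x) c d = (- (p x * hermitian_product c (F x))) *s d
      + (- (p x * hermitian_product d (F x))) *s c" for c d
      by (simp add: fs_christoffel_def fs_form_def p_def divide_inverse vec_eq_iff)
    show "(\<lambda>u. (p x * (hermitian_product (a x) (b' u) + hermitian_product (a' u) (b x))
          + - (p x * (hermitian_product (F x) (F' u) + hermitian_product (F' u) (F x)) * p x)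
            * hermitian_product (a x) (b x))
        - (p x * p x * (hermitian_product (a x) (F x)
              * (hermitian_product (F x) (b' u) + hermitian_product (F' u) (b x))
            + (hermitian_product (a x) (F' u) + hermitian_product (a' u) (F x))
              * hermitian_product (F x) (b x))
          + (p x * - (p x * (hermitian_product (F x) (F' u) + hermitian_product (F' u) (F x)) * p x)
            + - (p x * (hermitian_product (F x) (F' u) + hermitian_product (F' u) (F x)) * p x) * p x)
            * (hermitian_product (a x) (F x) * hermitian_product (F x) (b x)))) =
      (\<lambda>u. fs_hermitian (F x) (a' u + fs_christoffel (F x) (F' u) (a x)) (b x)
       + fs_hermitian (F x) (a x) (b' u + fs_christoffel (F x) (F' u) (b x)))" (is "?L = ?R")
    proof
      fix u
      \<comment> \<open>After expansion this is a polynomial identity in the real number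
        \<open>p x\<close> and the Hermitian products.\<close>
      show "?L u = ?R u"
        unfolding h g hermitian_product_add_left hermitian_product_add_right
          hermitian_product_scale_left hermitian_product_scale_right
          complex_cnj_minus complex_cnj_mult c cnj_hermitian_product
        by (simp add: algebra_simps)
    qed
  qed
  then show ?thesis
    by (simp add: fs_hermitian_def p_def divide_inverse power2_eq_square mult.assoc mult.left_commute mult.commute)
qed

lemma has_derivative_fubini_study:
  fixes F a b :: "'e::real_normed_vector \<Rightarrow> complex^'m::finite"
  assumes "(F has_derivative F') (at x)" and "(a has_derivative a') (at x)"
    and "(b has_derivative b') (at x)"
  shows "((\<lambda>z. fubini_study (F z) (a z) (b z)) has_derivative
    (\<lambda>u. fubini_study (F x) (a' u + fs_christoffel (F x) (F' u) (a x)) (b x)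
       + fubini_study (F x) (a x) (b' u + fs_christoffel (F x) (F' u) (b x)))) (at x)"
  using has_derivative_Re[OF has_derivative_fs_hermitian[OF assms]]
  by (simp add: fubini_study_eq_Re)

text \<open>The Koszul formula follows from metric compatibility and the symmetry of
  \<open>fs_christoffel\<close>; positivity makes its solution unique.\<close>

lemma christoffel_fubini_study:
  fixes w a b :: "complex^'m::finite"
  shows "christoffel fubini_study w a b = fs_christoffel w a b"
proof -
  interpret B: bounded_bilinear "fubini_study w"
    using bilinear_conv_bounded_bilinear bilinear_fubini_study by blast
  have D: "frechet_derivative (\<lambda>z. fubini_study z c d) (at w) e =
      fubini_study w (fs_christoffel w e c) d + fubini_study w c (fs_christoffel w e d)" for c d e
    using fun_cong[OF frechet_derivative_at[OF has_derivative_fubini_study[OF has_derivative_ident[of "at w"]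
        has_derivative_const[of c] has_derivative_const[of d]]], of e] by simp
  have eq: "2 * fubini_study w (fs_christoffel w a b) d =
     frechet_derivative (\<lambda>z. fubini_study z b d) (at w) a +
     frechet_derivative (\<lambda>z. fubini_study z a d) (at w) b -
     frechet_derivative (\<lambda>z. fubini_study z a b) (at w) d" for d
    unfolding D by (simp add: fs_christoffel_commute[of w b a] fs_christoffel_commute[of w d]
      fubini_study_commute[of w b])
  show ?thesis
    unfolding christoffel_def
  proof (rule the_equality, goal_cases)
    case (2 c)
    have "fubini_study w (c - fs_christoffel w a b) d = 0" for d
      using 2[rule_format, of d] eq[of d] by (simp only: B.diff_left)
    then show ?case
      using fubini_study_pos[of "c - fs_christoffel w a b" w] by fastforce
  qed (use eq in blast)
qed

section \<open>Covariant derivatives along a map into projective space\<close>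

lemma fs_form_add: "fs_form w (a + b) = fs_form w a + fs_form w b"
  and fs_form_scale: "fs_form w (k *s a) = k * fs_form w a"
  by (simp_all add: fs_form_def hermitian_product_add_left hermitian_product_scale_left add_divide_distrib)

text \<open>The part antilinear in \<open>F'\<close> is the metric itself, since \<partial> and its
  conjugate applied to the potential give the metric. It is what survives in the curvature.\<close>

lemma has_derivative_fs_form:
  fixes F a :: "'e::real_normed_vector \<Rightarrow> complex^'m::finite"
  assumes F: "(F has_derivative F') (at x)" and a: "(a has_derivative a') (at x)"
  shows "((\<lambda>z. fs_form (F z) (a z)) has_derivative
    (\<lambda>u. fs_form (F x) (a' u) + fs_hermitian (F x) (a x) (F' u)
       - fs_form (F x) (a x) * fs_form (F x) (F' u))) (at x)"
proof -
  note D = bounded_bilinear.FDERIV[OF bounded_bilinear_hermitian_product]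
  define p where "p = (\<lambda>z. inverse (1 + hermitian_product (F z) (F z)))"
  have r: "1 + hermitian_product (F x) (F x) \<noteq> 0"
    by (rule one_plus_hermitian_product_self_neq_0)
  have p: "(p has_derivative
      (\<lambda>u. - (p x * (hermitian_product (F x) (F' u) + hermitian_product (F' u) (F x)) * p x))) (at x)"
    unfolding p_def by (rule has_derivative_eq_rhs, (rule derivative_intros D F r)+) simp
  have h: "fs_hermitian (F x) c d = p x * hermitian_product c d
      - p x * p x * (hermitian_product c (F x) * hermitian_product (F x) d)"
    and g: "fs_form (F x) c = p x * hermitian_product c (F x)" for c d
    by (simp_all add: fs_hermitian_def fs_form_def p_def divide_inverse power2_eq_square)
  have "((\<lambda>z. p z * hermitian_product (a z) (F z)) has_derivative
    (\<lambda>u. fs_form (F x) (a' u) + fs_hermitian (F x) (a x) (F' u)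
       - fs_form (F x) (a x) * fs_form (F x) (F' u))) (at x)"
    by (rule has_derivative_eq_rhs, (rule derivative_intros D F a p)+)
      (simp add: fun_eq_iff h g algebra_simps)
  then show ?thesis
    by (simp add: fs_form_def p_def divide_inverse mult.commute)
qed

lemma has_derivative_fs_christoffel:
  fixes F a b :: "'e::real_normed_vector \<Rightarrow> complex^'m::finite"
  assumes F: "(F has_derivative F') (at x)" and a: "(a has_derivative a') (at x)"
    and b: "(b has_derivative b') (at x)"
  shows "((\<lambda>z. fs_christoffel (F z) (a z) (b z)) has_derivative
    (\<lambda>u. fs_christoffel (F x) (a' u) (b x) + fs_christoffel (F x) (a x) (b' u)
       - (fs_hermitian (F x) (a x) (F' u) - fs_form (F x) (a x) * fs_form (F x) (F' u)) *s b x
       - (fs_hermitian (F x) (b x) (F' u) - fs_form (F x) (b x) * fs_form (F x) (F' u)) *s a x)) (at x)"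
  unfolding fs_christoffel_def
  by (rule has_derivative_eq_rhs, (rule derivative_intros has_derivative_fs_form F a b
        bounded_bilinear.FDERIV[OF bounded_bilinear_vector_scalar_mult])+)
    (simp add: fun_eq_iff vec_eq_iff algebra_simps)

text \<open>The direction precedes the field, so \<open>fs_nabla F u a\<close> is again a field
  along \<open>F\<close> and can be differentiated further.\<close>

definition fs_nabla :: "('e::euclidean_space \<Rightarrow> complex^'m::finite) \<Rightarrow> 'e \<Rightarrow> ('e \<Rightarrow> complex^'m) \<Rightarrow> 'e \<Rightarrow> complex^'m"
  where "fs_nabla F u a x = dird u a x + fs_christoffel (F x) (dird u F x) (a x)"

lemma has_derivative_fubini_study_nabla:
  assumes "F differentiable (at x)" "a differentiable (at x)" "b differentiable (at x)"
  shows "((\<lambda>z. fubini_study (F z) (a z) (b z)) has_derivative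
    (\<lambda>u. fubini_study (F x) (fs_nabla F u a x) (b x) + fubini_study (F x) (a x) (fs_nabla F u b x))) (at x)"
  unfolding fs_nabla_def
  by (intro has_derivative_fubini_study assms[THEN has_derivative_dird])

lemma has_derivative_fs_nabla:
  assumes "F differentiable (at x)" "a differentiable (at x)" "dird u F differentiable (at x)"
    "dird u a differentiable (at x)"
  shows "((fs_nabla F u a) has_derivative (\<lambda>v. dird v (dird u a) x
       + (fs_christoffel (F x) (dird v (dird u F) x) (a x) + fs_christoffel (F x) (dird u F x) (dird v a x)
       - (fs_hermitian (F x) (dird u F x) (dird v F x) - fs_form (F x) (dird u F x) * fs_form (F x) (dird v F x)) *s a x
       - (fs_hermitian (F x) (a x) (dird v F x) - fs_form (F x) (a x) * fs_form (F x) (dird v F x)) *s dird u F x)))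
     (at x)"
  unfolding fs_nabla_def[abs_def]
  by (intro has_derivative_add has_derivative_fs_christoffel assms[THEN has_derivative_dird])

lemma fs_nabla_differentiable:
  assumes "smooth_on W F" "smooth_on W a" "x \<in> W"
  shows "fs_nabla F u a differentiable (at x)"
  using has_derivative_fs_nabla[of F x a u] smooth_on_differentiable[OF _ assms(3)] smooth_on_dird assms
  unfolding differentiable_def by blast

text \<open>Absence of torsion: second derivatives of \<open>F\<close> commute and the Christoffel
  symbols are symmetric.\<close>

lemma fs_nabla_commute:
  assumes "open W" "x \<in> W" "smooth_on W F"
  shows "fs_nabla F u (dird v F) x = fs_nabla F v (dird u F) x"
  using dird_commute[OF assms] by (simp add: fs_nabla_def fs_christoffel_commute)

text \<open>The curvature tensor of a space of constant holomorphic sectional curvature \<open>4\<close>.\<close>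

lemma fs_curvature:
  assumes W: "open W" "x \<in> W" and F: "smooth_on W F" and a: "smooth_on W a"
  shows "fs_nabla F u (fs_nabla F v a) x - fs_nabla F v (fs_nabla F u a) x =
    fs_hermitian (F x) (a x) (dird v F x) *s dird u F x - fs_hermitian (F x) (a x) (dird u F x) *s dird v F x
      + (fs_hermitian (F x) (dird u F x) (dird v F x) - fs_hermitian (F x) (dird v F x) (dird u F x)) *s a x"
proof -
  note d = smooth_on_differentiable[OF _ W(2)]
  have *: "dird u (fs_nabla F v a) x = dird u (dird v a) x
       + (fs_christoffel (F x) (dird u (dird v F) x) (a x) + fs_christoffel (F x) (dird v F x) (dird u a x)
       - (fs_hermitian (F x) (dird v F x) (dird u F x) - fs_form (F x) (dird v F x) * fs_form (F x) (dird u F x)) *s a x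
       - (fs_hermitian (F x) (a x) (dird u F x) - fs_form (F x) (a x) * fs_form (F x) (dird u F x)) *s dird v F x)"
    for u v
    by (rule dird_eqI[OF has_derivative_fs_nabla]) (intro d F a smooth_on_dird)+
  \<comment> \<open>A minus sign written as a complex scalar can be moved by
    \<open>fs_form_scale\<close>.\<close>
  have mi: "- b = (-1::complex) *s b" for b :: "complex^'b"
    by (simp add: vec_eq_iff)
  \<comment> \<open>Second derivatives cancel by symmetry, the products of \<open>fs_form\<close>
    cancel against the quadratic Christoffel terms, and only the \<open>fs_hermitian\<close> terms
    remain.\<close>
  show ?thesis
    unfolding fs_nabla_def[of F _ "fs_nabla _ _ _"] * dird_commute[OF W F, of v u] dird_commute[OF W a, of v u]
    unfolding fs_nabla_def fs_christoffel_def mi fs_form_add fs_form_scale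
    by (simp add: vec_eq_iff fs_form_add fs_form_scale algebra_simps)
qed

section \<open>The Codazzi equation\<close>

lemma linear_dird: "f differentiable (at x) \<Longrightarrow> linear (\<lambda>v. dird v f x)"
  by (rule has_derivative_linear[OF has_derivative_dird])

lemma dird_basis_sum:
  fixes f :: "'a::euclidean_space \<Rightarrow> 'b::euclidean_space"
  assumes "f differentiable (at x)"
  shows "dird v f x = (\<Sum>b\<in>Basis. (v \<bullet> b) *\<^sub>R dird b f x)"
proof -
  have "dird v f x = dird (\<Sum>b\<in>Basis. (v \<bullet> b) *\<^sub>R b) f x"
    by (simp add: euclidean_representation)
  also have "\<dots> = (\<Sum>b\<in>Basis. (v \<bullet> b) *\<^sub>R dird b f x)"
    by (simp only: linear_sum[OF linear_dird[OF assms]] linear_scale[OF linear_dird[OF assms]])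
  finally show ?thesis .
qed

text \<open>Expanding the direction in the basis gives a finite sum for the product rule. It
  differentiates tangent fields with variable coefficients.\<close>

lemma dird_dird_variable_direction:
  fixes f :: "'a::euclidean_space \<Rightarrow> 'b::euclidean_space"
  assumes W: "open W" "x \<in> W" and f: "smooth_on W f" and c: "c differentiable (at x)"
  shows "dird u (\<lambda>z. dird (c z) f z) x = dird (dird u c x) f x + dird u (dird (c x) f) x"
proof -
  note d = smooth_on_differentiable[OF f] smooth_on_differentiable[OF smooth_on_dird[OF f]]
  have *: "dird u (\<lambda>z. dird (k z) f z) x =
      (\<Sum>b\<in>Basis. (k x \<bullet> b) *\<^sub>R dird u (dird b f) x + (dird u k x \<bullet> b) *\<^sub>R dird b f x)"
    if k: "k differentiable (at x)" for k
  proof -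
    have "dird u (\<lambda>z. dird (k z) f z) x = dird u (\<lambda>z. \<Sum>b\<in>Basis. (k z \<bullet> b) *\<^sub>R dird b f z) x"
      by (rule dird_cong[OF W dird_basis_sum[OF d(1)]])
    also have "\<dots> = (\<Sum>b\<in>Basis. (k x \<bullet> b) *\<^sub>R dird u (dird b f) x + (dird u k x \<bullet> b) *\<^sub>R dird b f x)"
      by (rule dird_eqI) (intro has_derivative_sum has_derivative_scaleR has_derivative_inner_left
          has_derivative_dird k d(2) W(2))
    finally show ?thesis .
  qed
  have "dird u (\<lambda>_. c x) x = 0"
    by (rule dird_eqI) (rule has_derivative_const)
  with *[of "\<lambda>_. c x"] have "dird u (dird (c x) f) x = (\<Sum>b\<in>Basis. (c x \<bullet> b) *\<^sub>R dird u (dird b f) x)"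
    by simp
  with *[OF c] show ?thesis
    by (simp add: sum.distrib dird_basis_sum[OF d(1)[OF W(2)], of "dird u c x"])
qed

text \<open>The vector \<open>\<zeta>\<close> need not be normal; its normal part is the mean curvature vector.\<close>

definition umbilical_at :: "('e::euclidean_space \<Rightarrow> complex^'m::finite) \<Rightarrow> 'e \<Rightarrow> bool" where
  "umbilical_at F z \<longleftrightarrow> (\<exists>\<zeta>. \<forall>\<eta>. (\<forall>v. fubini_study (F z) \<eta> (dird v F z) = 0) \<longrightarrow>
     (\<forall>u v. fubini_study (F z) (fs_nabla F u (dird v F) z) \<eta> =
        fubini_study (F z) (dird u F z) (dird v F z) * fubini_study (F z) \<eta> \<zeta>))"

lemma bounded_bilinear_fubini_study: "bounded_bilinear (fubini_study w)"
  using bilinear_conv_bounded_bilinear bilinear_fubini_study by blast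

text \<open>The normal parts of the two terms are both
  \<open>\<langle>v, w\<rangle> \<zeta>\<close>, so they cancel. The resulting tangency no longer
  mentions \<zeta> and can be differentiated.\<close>

lemma umbilical_tangent_combination:
  assumes "umbilical_at F z" and F: "F differentiable (at z)" and w: "dird w F z \<noteq> 0"
  shows "\<exists>c. dird c F z = fs_nabla F v (dird w F) z
    - (fubini_study (F z) (dird v F z) (dird w F z) / fubini_study (F z) (dird w F z) (dird w F z))
      *\<^sub>R fs_nabla F w (dird w F) z" (is "\<exists>c. _ = ?S")
proof -
  interpret B: bounded_bilinear "fubini_study (F z)"
    by (rule bounded_bilinear_fubini_study)
  obtain \<zeta> where \<zeta>: "\<And>\<eta> u v. \<forall>v. fubini_study (F z) \<eta> (dird v F z) = 0 \<Longrightarrow>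
     fubini_study (F z) (fs_nabla F u (dird v F) z) \<eta> =
        fubini_study (F z) (dird u F z) (dird v F z) * fubini_study (F z) \<eta> \<zeta>"
    using assms(1) unfolding umbilical_at_def by meson
  have "subspace (range (\<lambda>v. dird v F z))"
    by (rule linear_subspace_image[OF linear_dird[OF F] subspace_UNIV])
  from orthogonal_decomposition_form[OF bilinear_fubini_study fubini_study_pos this, of "F z" ?S]
  obtain \<eta> c where \<eta>: "\<forall>v. fubini_study (F z) \<eta> (dird v F z) = 0" and c: "?S - \<eta> = dird c F z"
    by auto
  \<comment> \<open>The normal remainder is paired with itself: its tangential partner contributes
    nothing, and the \<zeta> terms of \<open>?S\<close> cancel.\<close>
  have "fubini_study (F z) \<eta> \<eta> = fubini_study (F z) ?S \<eta> - fubini_study (F z) (dird c F z) \<eta>"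
    unfolding c[symmetric] by (simp add: B.diff_left)
  also have "\<dots> = 0"
    using \<zeta>[OF \<eta>] fubini_study_pos[OF w, of "F z"] \<eta>
    by (simp add: B.diff_left B.scaleR_left fubini_study_commute[of _ "dird c F z" \<eta>])
  finally have "\<eta> = 0"
    using fubini_study_pos[of \<eta> "F z"] by force
  with c show ?thesis by auto
qed

text \<open>The rigorous form of differentiating h(v, w) = \<langle>v, w\<rangle> \<zeta> in
  direction \<open>u\<close>: the \<nabla>\<zeta> term carries the factor \<langle>v, w\<rangle>,
  which vanishes at \<open>x\<close>. Here \<open>\<mu>\<close> stands for \<langle>\<eta>,
  \<zeta>\<rangle> at \<open>x\<close>.\<close>

lemma umbilical_codazzi:
  fixes F :: "real^'n \<Rightarrow> complex^'m::finite"
  assumes W: "open W" "x \<in> W" and F: "smooth_on W F"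
    and inj: "\<And>z. z \<in> W \<Longrightarrow> inj (\<lambda>v. dird v F z)"
    and umb: "\<And>z. z \<in> W \<Longrightarrow> umbilical_at F z"
    and \<eta>: "\<And>v. fubini_study (F x) \<eta> (dird v F x) = 0"
    and \<mu>: "\<And>u v. fubini_study (F x) (fs_nabla F u (dird v F) x) \<eta> =
      fubini_study (F x) (dird u F x) (dird v F x) * \<mu>"
    and w: "w \<noteq> 0" and vw: "fubini_study (F x) (dird v F x) (dird w F x) = 0"
  shows "fubini_study (F x) (fs_nabla F u (fs_nabla F v (dird w F)) x) \<eta> =
    (fubini_study (F x) (dird u F x) (fs_nabla F v (dird w F) x)
      + fubini_study (F x) (fs_nabla F u (dird v F) x) (dird w F x)
      + fubini_study (F x) (dird v F x) (fs_nabla F u (dird w F) x)) * \<mu>"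
proof -
  interpret B: bounded_bilinear "fubini_study (F x)"
    by (rule bounded_bilinear_fubini_study)
  note d = smooth_on_differentiable[OF F] smooth_on_differentiable[OF smooth_on_dird[OF F]]
  have w0: "dird w F z \<noteq> 0" if "z \<in> W" for z
    using linear_injective_0[OF linear_dird[OF d(1)[OF that]]] inj[OF that] w by blast
  let ?g = "\<lambda>v z. fubini_study (F z) (dird v F z) (dird w F z)"
  define S where "S = (\<lambda>z. fs_nabla F v (dird w F) z - (?g v z / ?g w z) *\<^sub>R fs_nabla F w (dird w F) z)"
  \<comment> \<open>\<open>S\<close> is tangent throughout \<open>W\<close>; its coefficients are
    picked point by point, and their differentiability is recovered below.\<close>
  have "\<forall>z. \<exists>c. z \<in> W \<longrightarrow> dird c F z = S z"
    unfolding S_def using umbilical_tangent_combination[OF umb d(1) w0] by blast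
  from choice[OF this] obtain c where c: "\<And>z. z \<in> W \<Longrightarrow> dird (c z) F z = S z"
    by blast
  have g: "((?g a) has_derivative (\<lambda>u. fubini_study (F x) (fs_nabla F u (dird a F) x) (dird w F x)
      + fubini_study (F x) (dird a F x) (fs_nabla F u (dird w F) x))) (at x)" for a
    by (intro has_derivative_fubini_study_nabla d W(2))
  have gw: "?g w x > 0"
    by (rule fubini_study_pos[OF w0[OF W(2)]])
  define g' where "g' = (\<lambda>u. fubini_study (F x) (fs_nabla F u (dird v F) x) (dird w F x)
      + fubini_study (F x) (dird v F x) (fs_nabla F u (dird w F) x))"
  \<comment> \<open>The numerator vanishes at \<open>x\<close>, so the quotient rule leaves only its
    derivative.\<close>
  have q: "((\<lambda>z. ?g v z / ?g w z) has_derivative (\<lambda>u. g' u / ?g w x)) (at x)"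
    by (rule has_derivative_eq_rhs, rule has_derivative_divide[OF g g])
      (use gw in \<open>simp_all add: vw g'_def fun_eq_iff divide_inverse\<close>)
  have N: "(fs_nabla F a (dird w F) has_derivative (\<lambda>u. dird u (fs_nabla F a (dird w F)) x)) (at x)" for a
    by (intro has_derivative_dird fs_nabla_differentiable[OF F smooth_on_dird[OF F] W(2)])
  have S': "(S has_derivative (\<lambda>u. dird u (fs_nabla F v (dird w F)) x
      - (g' u / ?g w x) *\<^sub>R fs_nabla F w (dird w F) x)) (at x)"
    unfolding S_def
    by (rule has_derivative_eq_rhs, rule has_derivative_diff[OF N has_derivative_scaleR[OF q N]])
      (simp add: vw)
  have "((\<lambda>z. dird (c z) F z) has_derivative (\<lambda>u. dird u (fs_nabla F v (dird w F)) x
      - (g' u / ?g w x) *\<^sub>R fs_nabla F w (dird w F) x)) (at x)"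
    using S' W by (rule has_derivative_transform_within_open) (simp add: c)
  then have cd: "c differentiable (at x)"
    by (intro differentiable_linear_preimage[OF W linear_dird[OF d(1)] d(2)[OF W(2)] inj[OF W(2)]])
      (auto simp: differentiable_def)
  have Sx: "S x = fs_nabla F v (dird w F) x"
    by (simp add: S_def vw)
  \<comment> \<open>Read as dF(c), the derivative of \<open>S\<close> has a tangential part, killed
    by \<eta>, and a second fundamental form term evaluated on \<open>u\<close> and
    \<open>c x\<close>.\<close>
  have "dird u S x = dird u (\<lambda>z. dird (c z) F z) x"
    by (rule dird_cong[OF W]) (simp add: c)
  also have "\<dots> = dird (dird u c x) F x + dird u (dird (c x) F) x"
    by (rule dird_dird_variable_direction[OF W F cd])
  also have "dird u (dird (c x) F) x = fs_nabla F u (dird (c x) F) x - fs_christoffel (F x) (dird u F x) (S x)"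
    by (simp add: fs_nabla_def c[OF W(2)])
  finally have "fubini_study (F x) (dird u S x) \<eta> =
      fubini_study (F x) (dird u F x) (S x) * \<mu>
        - fubini_study (F x) (fs_christoffel (F x) (dird u F x) (S x)) \<eta>"
    using \<eta>[of "dird u c x"] \<mu>[of u "c x"] c[OF W(2)]
    by (simp add: B.add_right B.diff_right fubini_study_commute[of _ _ \<eta>])
  \<comment> \<open>Read from its definition, the same derivative involves h(w, w), whose factor
    \<langle>w, w\<rangle> cancels the denominator.\<close>
  moreover have "fubini_study (F x) (dird u S x) \<eta> =
      fubini_study (F x) (dird u (fs_nabla F v (dird w F)) x) \<eta> - g' u * \<mu>"
    using \<mu>[of w w] gw by (simp add: dird_eqI[OF S'] B.diff_left B.scaleR_left)
  ultimately show ?thesis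
    unfolding fs_nabla_def[of F u "fs_nabla _ _ _"] B.add_left Sx g'_def by algebra
qed

text \<open>Exchanging \<open>u\<close> and \<open>v\<close> leaves the right side of
  \<open>umbilical_codazzi\<close> unchanged, since the connection is torsion-free. So the curvature
  applied to \<open>w\<close> has no component along the normal vector
  \<open>\<i> *s dird w F x\<close>, which the explicit curvature contradicts.\<close>

lemma umbilical_no_CR_triple:
  fixes F :: "real^'n \<Rightarrow> complex^'m::finite"
  assumes W: "open W" "x \<in> W" and F: "smooth_on W F"
    and inj: "\<And>z. z \<in> W \<Longrightarrow> inj (\<lambda>v. dird v F z)"
    and umb: "\<And>z. z \<in> W \<Longrightarrow> umbilical_at F z"
    and uv: "dird v F x = \<i> *s dird u F x" and u0: "dird u F x \<noteq> 0" and w0: "dird w F x \<noteq> 0"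
    and uw: "fubini_study (F x) (dird u F x) (dird w F x) = 0"
    and vw: "fubini_study (F x) (dird v F x) (dird w F x) = 0"
    and \<eta>: "\<And>y. fubini_study (F x) (\<i> *s dird w F x) (dird y F x) = 0"
  shows False
proof -
  interpret B: bounded_bilinear "fubini_study (F x)"
    by (rule bounded_bilinear_fubini_study)
  define \<eta> where "\<eta> = \<i> *s dird w F x"
  have \<eta>': "\<And>y. fubini_study (F x) \<eta> (dird y F x) = 0"
    using \<eta> by (simp add: \<eta>_def)
  obtain \<zeta> where \<zeta>: "\<And>u v. fubini_study (F x) (fs_nabla F u (dird v F) x) \<eta> =
        fubini_study (F x) (dird u F x) (dird v F x) * fubini_study (F x) \<eta> \<zeta>"
    using umb[OF W(2)] \<eta>' unfolding umbilical_at_def by meson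
  have w: "w \<noteq> 0"
    using w0 linear_0[OF linear_dird[OF smooth_on_differentiable[OF F W(2)]]] by auto
  have cod: "fubini_study (F x) (fs_nabla F a (fs_nabla F b (dird w F)) x) \<eta> =
    (fubini_study (F x) (dird a F x) (fs_nabla F b (dird w F) x)
      + fubini_study (F x) (fs_nabla F a (dird b F) x) (dird w F x)
      + fubini_study (F x) (dird b F x) (fs_nabla F a (dird w F) x)) * fubini_study (F x) \<eta> \<zeta>"
    if "fubini_study (F x) (dird b F x) (dird w F x) = 0" for a b
    using that by (intro umbilical_codazzi[OF W F] inj umb \<eta>' \<zeta> w)
  have "fubini_study (F x) (fs_nabla F u (fs_nabla F v (dird w F)) x
      - fs_nabla F v (fs_nabla F u (dird w F)) x) \<eta> = 0"
    unfolding B.diff_left cod[OF uw] cod[OF vw] fs_nabla_commute[OF W F, of u v] by algebra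
  then have R: "Re (fs_hermitian (F x) (fs_hermitian (F x) (dird w F x) (dird v F x) *s dird u F x
      - fs_hermitian (F x) (dird w F x) (dird u F x) *s dird v F x
      + (fs_hermitian (F x) (dird u F x) (dird v F x) - fs_hermitian (F x) (dird v F x) (dird u F x)) *s dird w F x) \<eta>) = 0"
    unfolding fs_curvature[OF W F smooth_on_dird[OF F]] fubini_study_eq_Re .
  \<comment> \<open>Real orthogonality to both a vector and its multiple by \<i> is Hermitian
    orthogonality.\<close>
  have "fs_hermitian (F x) (dird u F x) (dird w F x) = 0"
    using uw vw by (simp add: uv fubini_study_eq_Re fs_hermitian_scale_left complex_eq_iff)
  then have wu: "fs_hermitian (F x) (dird w F x) (dird u F x) = 0"
    using cnj_fs_hermitian[of "F x" "dird u F x" "dird w F x"] by simp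
  have Q: "fs_hermitian (F x) a a = of_real (fubini_study (F x) a a)" for a
    using cnj_fs_hermitian[of "F x" a a] by (simp add: fubini_study_eq_Re complex_eq_iff)
  \<comment> \<open>As v = iu, the last coefficient is -2i|u|^2, so the curvature vector is -2|u|^2
    iw; its product with iw is -2|u|^2 |w|^2.\<close>
  from R have "fubini_study (F x) (dird u F x) (dird u F x) * fubini_study (F x) (dird w F x) (dird w F x) = 0"
    by (simp add: uv wu \<eta>_def fs_hermitian_scale_left fs_hermitian_scale_right fs_hermitian_add_left
        fs_hermitian_scaleR_left[of _ "-1", simplified] Q)
  then show False
    using fubini_study_pos[OF u0, of "F x"] fubini_study_pos[OF w0, of "F x"] by simp
qed

section \<open>Maximal CR dimension\<close>

lemma tangent_space_eq: "tangent_space F x = range (\<lambda>v. dird v F x)"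
  by (simp add: tangent_space_def dird_def)

lemma subspace_tangent_space: "F differentiable (at x) \<Longrightarrow> subspace (tangent_space F x)"
  unfolding tangent_space_eq by (rule linear_subspace_image[OF linear_dird subspace_UNIV])

lemma linear_cstruct: "linear cstruct"
  by (rule linearI) (simp_all add: cstruct_def vec_eq_iff algebra_simps)

lemma cstruct_cstruct: "cstruct (cstruct a) = - a"
  by (simp add: cstruct_def vec_eq_iff)

lemma fubini_study_cstruct:
  fixes a b :: "complex^'m::finite"
  shows "fubini_study w (cstruct a) (cstruct b) = fubini_study w a b"
  by (simp add: cstruct_def fubini_study_eq_Re fs_hermitian_scale_left fs_hermitian_scale_right)

lemma fubini_study_cstruct_self:
  fixes a :: "complex^'m::finite"
  shows "fubini_study w (cstruct a) a = 0"
proof -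
  have "Im (fs_hermitian w a a) = 0"
    using arg_cong[OF cnj_fs_hermitian[of w a a], of Im] by simp
  then show ?thesis
    by (simp add: cstruct_def fubini_study_eq_Re fs_hermitian_scale_left)
qed

text \<open>\<open>H\<close> is a complex subspace of codimension one in \<open>T\<close>, so
  \<open>T\<close> is spanned by \<open>H\<close> and one \<open>Z\<close> orthogonal to it. J is an
  isometry preserving \<open>H\<close>, hence JZ is orthogonal to \<open>H\<close>, and it is always
  orthogonal to \<open>Z\<close>.\<close>

lemma maximal_CR_subspace:
  fixes T :: "(complex^'m::finite) set"
  assumes T: "subspace T" and dimT: "dim T > 1"
    and dimH: "dim (cstruct ` T \<inter> T) = dim T - 1"
  obtains X Z where "X \<in> T" "cstruct X \<in> T" "X \<noteq> 0" "Z \<in> T" "Z \<noteq> 0"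
    "fubini_study w X Z = 0" "fubini_study w (cstruct X) Z = 0"
    "\<And>y. y \<in> T \<Longrightarrow> fubini_study w (cstruct Z) y = 0"
proof -
  interpret B: bounded_bilinear "fubini_study w"
    by (rule bounded_bilinear_fubini_study)
  define H where "H = cstruct ` T \<inter> T"
  have H: "subspace H"
    unfolding H_def by (intro subspace_inter T linear_subspace_image linear_cstruct)
  have JH: "cstruct h \<in> H" if "h \<in> H" for h
    using that subspace_neg[OF T] by (auto simp: H_def cstruct_cstruct)
  have "dim H \<noteq> 0"
    using dimT dimH by (simp add: H_def)
  then obtain X where X: "X \<in> H" "X \<noteq> 0"
    by auto
  have "\<not> T \<subseteq> H"
    using dim_subset[of T H] dimT dimH unfolding H_def by linarith
  then obtain t where t: "t \<in> T" "t \<notin> H"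
    by blast
  \<comment> \<open>\<open>Z\<close> is the component of \<open>t\<close> orthogonal to
    \<open>H\<close>; it is nonzero because \<open>t\<close> lies outside \<open>H\<close>.\<close>
  obtain Z where Z: "\<forall>h\<in>H. fubini_study w Z h = 0" "t - Z \<in> H"
    using orthogonal_decomposition_form[OF bilinear_fubini_study fubini_study_pos H] by blast
  have ZT: "Z \<in> T"
    using subspace_diff[OF T t(1), of "t - Z"] Z(2) by (simp add: H_def)
  have Z0: "Z \<noteq> 0"
    using t Z by auto
  then have "Z \<notin> H"
    using fubini_study_pos[OF Z0, of w] Z(1) by force
  have spanH: "span H = H"
    using H span_eq_iff by blast
  have ZH: "Z \<notin> span H"
    unfolding spanH by fact
  have "span (insert Z H) = T"
  proof (rule subspace_dim_equal[OF subspace_span T])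
    show "span (insert Z H) \<subseteq> T"
      using ZT by (intro span_minimal T) (auto simp: H_def)
    have "dim (insert Z H) = dim T"
      unfolding dim_insert using ZH dimT dimH[folded H_def] by simp
    then show "dim T \<le> dim (span (insert Z H))"
      by simp
  qed
  have N: "fubini_study w (cstruct Z) y = 0" if "y \<in> T" for y
  proof -
    obtain k where "y - k *\<^sub>R Z \<in> span H"
      using \<open>y \<in> T\<close> unfolding \<open>span (insert Z H) = T\<close>[symmetric] span_breakdown_eq ..
    then have k: "y - k *\<^sub>R Z \<in> H"
      by (simp only: spanH)
    have "fubini_study w (cstruct Z) (y - k *\<^sub>R Z) = - fubini_study w Z (cstruct (y - k *\<^sub>R Z))"
      using fubini_study_cstruct[of w "cstruct Z" "y - k *\<^sub>R Z"]
      by (simp add: cstruct_cstruct B.minus_left)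
    also have "\<dots> = 0"
      using Z(1) JH[OF k] by simp
    finally show ?thesis
      by (simp add: B.diff_right B.scaleR_right fubini_study_cstruct_self)
  qed
  show thesis
    by (rule that[of X Z])
      (use X JH[OF X(1)] ZT Z0 Z(1) N in \<open>auto simp: H_def fubini_study_commute[of w _ Z]\<close>)
qed

section \<open>Immersions in coordinates\<close>

lemma openin_affine_domain:
  fixes i :: "'m::finite option"
  shows "openin cproj_topology (affine_domain i)"
proof -
  have "(z \<noteq> 0 \<and> vec.span {z} \<in> affine_domain i) \<longleftrightarrow> z $ i \<noteq> 0" for z :: "complex^'m option"
  proof
    assume *: "z $ i \<noteq> 0"
    then have "z \<noteq> 0"
      by auto
    moreover have "z \<in> vec.span {z}"
      by (simp add: vec.span_base)
    ultimately show "z \<noteq> 0 \<and> vec.span {z} \<in> affine_domain i"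
      using * unfolding affine_domain_def cproj_def by blast
  next
    assume "z \<noteq> 0 \<and> vec.span {z} \<in> affine_domain i"
    then obtain y where "y \<in> vec.span {z}" "y $ i \<noteq> 0"
      unfolding affine_domain_def by blast
    then show "z $ i \<noteq> 0"
      unfolding vec.span_singleton by auto
  qed
  then have "{z. z \<noteq> 0 \<and> vec.span {z} \<in> affine_domain i} = {z::complex^'m option. z $ i \<noteq> 0}"
    by (rule Collect_cong)
  moreover have "open {z::complex^'m option. z $ i \<noteq> 0}"
    by (intro open_Collect_neq continuous_on_component continuous_on_id continuous_on_const)
  moreover have "affine_domain i \<subseteq> cproj"
    unfolding affine_domain_def by blast
  ultimately show ?thesis
    unfolding openin_cproj_topology by simp
qed

lemma cproj_subset_affine_domains: "L \<in> cproj \<Longrightarrow> \<exists>i. L \<in> affine_domain i"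
proof -
  assume "L \<in> cproj"
  then obtain z where z: "z \<noteq> 0" "L = vec.span {z}"
    unfolding cproj_def by blast
  then obtain i where "z $ i \<noteq> 0"
    unfolding vec_eq_iff zero_index by blast
  moreover have "z \<in> L"
    using z(2) by (simp add: vec.span_base)
  ultimately show ?thesis
    using \<open>L \<in> cproj\<close> unfolding affine_domain_def by blast
qed

text \<open>All geometric conditions quantify over coordinate expressions, so a contradiction needs
  one with a point in its domain. The manifold is nonempty and the affine charts cover projective
  space.\<close>

lemma local_rep_domain_nonempty:
  fixes f :: "'a \<Rightarrow> (complex ^ 'm::finite option) set"
  assumes "cproj_submanifold X A f"
  shows "\<exists>W F. (W, F) \<in> local_reps A cproj_atlas f \<and> W \<noteq> {}"
proof -
  obtain x where x: "x \<in> topspace X"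
    using assms unfolding cproj_submanifold_def by blast
  have "f x \<in> topspace cproj_topology"
    using assms x unfolding cproj_submanifold_def smooth_immersion_def smooth_map_def continuous_map_def by blast
  moreover have "topspace cproj_topology \<subseteq> (cproj :: (complex ^ 'm option) set set)"
    using openin_topspace openin_cproj_topology by blast
  ultimately obtain i where i: "f x \<in> affine_domain i"
    using cproj_subset_affine_domains by blast
  have "x \<in> (\<Union>(U, \<phi>)\<in>A. U)"
    using assms x unfolding cproj_submanifold_def smooth_manifold_def by simp
  then obtain U \<phi> where U: "(U, \<phi>) \<in> A" "x \<in> U"
    by auto
  have "(affine_domain i, affine_coords i) \<in> cproj_atlas"
    by (auto simp: cproj_atlas_def)
  with U(1) have "(\<phi> ` {x \<in> U. f x \<in> affine_domain i}, affine_coords i \<circ> f \<circ> inv_into U \<phi>)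
      \<in> local_reps A cproj_atlas f"
    unfolding local_reps_def by blast
  moreover have "\<phi> ` {x \<in> U. f x \<in> affine_domain i} \<noteq> {}"
    using U(2) i by auto
  ultimately show ?thesis
    by (intro exI conjI)
qed

text \<open>\<open>f\<close> is continuous, affine domains are open, and a chart is a homeomorphism
  onto an open set.\<close>

lemma open_local_rep_domain:
  assumes M: "cproj_submanifold X A f" and WF: "(W, F) \<in> local_reps A cproj_atlas f"
  shows "open W"
proof -
  obtain U \<phi> i where W: "W = \<phi> ` {x \<in> U. f x \<in> affine_domain i}" and U: "(U, \<phi>) \<in> A"
    using WF by (auto simp: local_reps_def cproj_atlas_def)
  have "is_chart X (U, \<phi>)"
    using M U unfolding cproj_submanifold_def smooth_manifold_def by blast
  then have chart: "openin X U" "open (\<phi> ` U)"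
      "homeomorphic_map (subtopology X U) (top_of_set (\<phi> ` U)) \<phi>"
    by (auto simp: is_chart_def)
  have "continuous_map X cproj_topology f"
    using M unfolding cproj_submanifold_def smooth_immersion_def smooth_map_def by blast
  then have "openin X {x \<in> topspace X. f x \<in> affine_domain i}"
    using openin_affine_domain by (rule openin_continuous_map_preimage)
  then have "openin (subtopology X U) (U \<inter> {x \<in> topspace X. f x \<in> affine_domain i})"
    by (rule openin_subtopology_Int2)
  moreover have "U \<inter> {x \<in> topspace X. f x \<in> affine_domain i} = {x \<in> U. f x \<in> affine_domain i}"
    using openin_subset[OF chart(1)] by blast
  ultimately have "openin (top_of_set (\<phi> ` U)) W"
    unfolding W using homeomorphic_imp_open_map[OF chart(3)] by (simp add: open_map_def)
  then show ?thesis
    using chart(2) openin_open_trans by blast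
qed

lemma local_rep_smooth:
  assumes "cproj_submanifold X A f" "(W, F) \<in> local_reps A cproj_atlas f"
  shows "smooth_on W F" and "\<And>z. z \<in> W \<Longrightarrow> inj (\<lambda>v. dird v F z)"
proof -
  have "\<forall>(W, F)\<in>local_reps A cproj_atlas f. smooth_on W F"
    and "\<forall>(W, F)\<in>local_reps A cproj_atlas f. \<forall>x\<in>W. inj (frechet_derivative F (at x))"
    using assms(1) unfolding cproj_submanifold_def smooth_immersion_def smooth_map_def by argo+
  from this[THEN bspec, OF assms(2)] show "smooth_on W F" and "\<And>z. z \<in> W \<Longrightarrow> inj (\<lambda>v. dird v F z)"
    by (simp_all add: dird_def)
qed

lemma normal_part_fubini_study:
  fixes F :: "'e::euclidean_space \<Rightarrow> complex^'m::finite"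
  assumes "F differentiable (at x)"
  shows "normal_part fubini_study F x w \<in> normal_space fubini_study F x \<and>
    w - normal_part fubini_study F x w \<in> tangent_space F x"
  unfolding normal_part_def
proof (rule theI')
  interpret B: bounded_bilinear "fubini_study (F x)"
    by (rule bounded_bilinear_fubini_study)
  note T = subspace_tangent_space[OF assms]
  \<comment> \<open>Existence is orthogonal decomposition; uniqueness holds because the difference
    of two candidates is both normal and tangent.\<close>
  show "\<exists>!\<eta>. \<eta> \<in> normal_space fubini_study F x \<and> w - \<eta> \<in> tangent_space F x"
  proof (rule ex_ex1I)
    show "\<exists>\<eta>. \<eta> \<in> normal_space fubini_study F x \<and> w - \<eta> \<in> tangent_space F x"
      using orthogonal_decomposition_form[OF bilinear_fubini_study fubini_study_pos T]
      by (simp add: normal_space_def)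
    fix \<eta> \<theta>
    assume *: "\<eta> \<in> normal_space fubini_study F x \<and> w - \<eta> \<in> tangent_space F x"
      "\<theta> \<in> normal_space fubini_study F x \<and> w - \<theta> \<in> tangent_space F x"
    then have "\<eta> - \<theta> \<in> tangent_space F x"
      using subspace_diff[OF T, of "w - \<theta>" "w - \<eta>"] by simp
    then have "fubini_study (F x) (\<eta> - \<theta>) (\<eta> - \<theta>) = 0"
      using * by (simp add: normal_space_def B.diff_left)
    then show "\<eta> = \<theta>"
      using fubini_study_pos[of "\<eta> - \<theta>" "F x"] by force
  qed
qed

text \<open>What \<open>normal_part\<close> removes is tangent, hence invisible to a normal
  \<eta>.\<close>

lemma second_fundamental_form_normal:
  fixes F :: "'e::euclidean_space \<Rightarrow> complex^'m::finite"
  assumes F: "F differentiable (at x)" and \<eta>: "\<eta> \<in> normal_space fubini_study F x"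
  shows "fubini_study (F x) (second_fundamental_form fubini_study F x u v) \<eta> =
    fubini_study (F x) (fs_nabla F u (dird v F) x) \<eta>"
proof -
  interpret B: bounded_bilinear "fubini_study (F x)"
    by (rule bounded_bilinear_fubini_study)
  have II: "second_fundamental_form fubini_study F x u v = normal_part fubini_study F x (fs_nabla F u (dird v F) x)"
    by (simp add: second_fundamental_form_def covariant_derivative_def christoffel_fubini_study
        fs_nabla_def dird_def[abs_def])
  have "fs_nabla F u (dird v F) x - second_fundamental_form fubini_study F x u v \<in> tangent_space F x"
    unfolding II using normal_part_fubini_study[OF F] by blast
  then have "fubini_study (F x) \<eta> (fs_nabla F u (dird v F) x - second_fundamental_form fubini_study F x u v) = 0"
    using \<eta> by (simp add: normal_space_def)
  then show ?thesis
    by (simp add: B.diff_right fubini_study_commute[of _ _ \<eta>])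
qed

lemma normal_spaceI: "(\<And>v. G (F x) \<eta> (dird v F x) = 0) \<Longrightarrow> \<eta> \<in> normal_space G F x"
  by (auto simp: normal_space_def tangent_space_eq)

lemma totally_geodesic_umbilical_at:
  fixes F :: "'e::euclidean_space \<Rightarrow> complex^'m::finite"
  assumes F: "F differentiable (at x)"
    and "\<And>u v. second_fundamental_form fubini_study F x u v = 0"
  shows "umbilical_at F x"
proof -
  interpret B: bounded_bilinear "fubini_study (F x)"
    by (rule bounded_bilinear_fubini_study)
  have "fubini_study (F x) (fs_nabla F u (dird v F) x) \<eta> = 0"
    if "\<forall>v. fubini_study (F x) \<eta> (dird v F x) = 0" for \<eta> u v
    using second_fundamental_form_normal[OF F normal_spaceI, of \<eta> u v] that assms(2)
    by (simp add: B.zero_left)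
  then show ?thesis
    unfolding umbilical_at_def by (intro exI[of _ 0]) (simp add: B.zero_right)
qed

lemma linear_fs_nabla:
  assumes "F differentiable (at x)" and "a differentiable (at x)"
  shows "linear (\<lambda>v. fs_nabla F v a x)"
  unfolding fs_nabla_def fs_christoffel_def
  by (rule linearI)
    (simp_all add: linear_add[OF linear_dird] linear_scale[OF linear_dird] assms fs_form_add fs_form_scale
      scaleR_eq_vector_scalar_mult vec_eq_iff algebra_simps)

lemma shape_operator_fubini_study:
  fixes F :: "'e::euclidean_space \<Rightarrow> complex^'m::finite"
  assumes W: "open W" "x \<in> W" and F: "smooth_on W F" and inj: "inj (\<lambda>v. dird v F x)"
    and \<eta>: "\<eta> \<in> normal_space fubini_study F x"
  shows "fubini_study (F x) (dird (shape_operator fubini_study F x \<eta> u) F x) (dird v F x) =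
    fubini_study (F x) (fs_nabla F u (dird v F) x) \<eta>"
proof -
  interpret B: bounded_bilinear "fubini_study (F x)"
    by (rule bounded_bilinear_fubini_study)
  note d = smooth_on_differentiable[OF F W(2)] smooth_on_differentiable[OF smooth_on_dird[OF F] W(2)]
  note lin = linear_dird[OF d(1)] linear_dird[OF d(2)]
  have g: "induced_metric fubini_study F x a b = fubini_study (F x) (dird a F x) (dird b F x)" for a b
    by (simp add: induced_metric_def dird_def)
  have "\<exists>!a. \<forall>v. induced_metric fubini_study F x a v =
      fubini_study (F x) (second_fundamental_form fubini_study F x u v) \<eta>"
  proof (rule Riesz_form)
    show "bilinear (induced_metric fubini_study F x)"
      unfolding bilinear_def g
      by (auto intro!: linearI simp: linear_add[OF lin(1)] linear_scale[OF lin(1)] B.add_left B.add_right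
          B.scaleR_left B.scaleR_right)
    show "0 < induced_metric fubini_study F x a a" if "a \<noteq> 0" for a
      unfolding g using inj that linear_injective_0[OF lin(1)] by (intro fubini_study_pos) blast
    \<comment> \<open>\<open>fs_nabla\<close> is visibly linear in its direction, so symmetry first
      moves \<open>v\<close> into that slot.\<close>
    show "linear (\<lambda>v. fubini_study (F x) (second_fundamental_form fubini_study F x u v) \<eta>)"
      unfolding second_fundamental_form_normal[OF d(1) \<eta>] fs_nabla_commute[OF W F, of u]
      using linear_compose[OF linear_fs_nabla[OF d] bounded_linear.linear[OF B.bounded_linear_left]]
      by (simp add: o_def)
  qed
  then have "\<forall>v. induced_metric fubini_study F x (shape_operator fubini_study F x \<eta> u) v =
      fubini_study (F x) (second_fundamental_form fubini_study F x u v) \<eta>"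
    unfolding shape_operator_def by (rule theI')
  then show ?thesis
    unfolding g second_fundamental_form_normal[OF d(1) \<eta>] ..
qed

text \<open>\<zeta> is a parameter, later instantiated with \<open>mean_curvature\<close>;
  \<open>umbilical_at\<close> asks for some vector of this kind.\<close>

lemma totally_umbilical_umbilical_at:
  fixes F :: "'e::euclidean_space \<Rightarrow> complex^'m::finite"
  assumes W: "open W" "x \<in> W" and F: "smooth_on W F" and inj: "inj (\<lambda>v. dird v F x)"
    and umb: "\<And>\<eta> u. \<eta> \<in> normal_space fubini_study F x \<Longrightarrow>
       shape_operator fubini_study F x \<eta> u = fubini_study (F x) \<eta> \<zeta> *\<^sub>R u"
  shows "umbilical_at F x"
proof -
  interpret B: bounded_bilinear "fubini_study (F x)"
    by (rule bounded_bilinear_fubini_study)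
  note lin = linear_dird[OF smooth_on_differentiable[OF F W(2)]]
  have "fubini_study (F x) (fs_nabla F u (dird v F) x) \<eta> =
        fubini_study (F x) (dird u F x) (dird v F x) * fubini_study (F x) \<eta> \<zeta>"
    if "\<forall>v. fubini_study (F x) \<eta> (dird v F x) = 0" for \<eta> u v
  proof -
    have \<eta>: "\<eta> \<in> normal_space fubini_study F x"
      using that by (intro normal_spaceI) simp
    show ?thesis
      using shape_operator_fubini_study[OF W F inj \<eta>, of u v]
      by (simp add: umb[OF \<eta>] linear_scale[OF lin] B.scaleR_left mult.commute)
  qed
  then show ?thesis
    unfolding umbilical_at_def by blast
qed

text \<open>Common end of both cases. The contradiction occurs at one point, but umbilicity enters
  on a whole neighbourhood because it is differentiated.\<close>

lemma no_umbilical_CR_maximal_dim: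
  fixes f :: "'a \<Rightarrow> (complex ^ 'm::finite option) set" and A :: "('a, real ^ 'n) chart set"
  assumes M: "cproj_submanifold X A f" and CR: "CR_maximal_dim A f" and n: "CARD('n) > 1"
    and umb: "\<And>W F z. (W, F) \<in> local_reps A cproj_atlas f \<Longrightarrow> z \<in> W \<Longrightarrow> umbilical_at F z"
  shows False
proof -
  obtain W F x where WF: "(W, F) \<in> local_reps A cproj_atlas f" and x: "x \<in> W"
    using local_rep_domain_nonempty[OF M] by blast
  note W = open_local_rep_domain[OF M WF] x
  note F = local_rep_smooth[OF M WF]
  have lin: "linear (\<lambda>v. dird v F x)"
    by (rule linear_dird[OF smooth_on_differentiable[OF F(1) x]])
  \<comment> \<open>An immersion has tangent spaces of dimension n, so maximal CR dimension means
    codimension one in the tangent space.\<close>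
  have dim: "dim (tangent_space F x) = CARD('n)"
    unfolding tangent_space_eq using dim_image_eq[OF lin, of UNIV] F(2)[OF x] by simp
  have CRdim: "dim (cstruct ` tangent_space F x \<inter> tangent_space F x) = dim (tangent_space F x) - 1"
    using CR WF x unfolding CR_maximal_dim_def holomorphic_tangent_space_def dim by blast
  obtain V Z where V: "V \<in> tangent_space F x" "cstruct V \<in> tangent_space F x" "V \<noteq> 0"
      and Z: "Z \<in> tangent_space F x" "Z \<noteq> 0"
        "fubini_study (F x) V Z = 0" "fubini_study (F x) (cstruct V) Z = 0"
        "\<And>y. y \<in> tangent_space F x \<Longrightarrow> fubini_study (F x) (cstruct Z) y = 0"
    by (rule maximal_CR_subspace[OF subspace_tangent_space[OF smooth_on_differentiable[OF F(1) x]] _ CRdim, of "F x"])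
      (use n dim in simp_all)
  obtain u v w where "V = dird u F x" "cstruct V = dird v F x" "Z = dird w F x"
    using V(1,2) Z(1) by (auto simp: tangent_space_eq)
  note eqs = this
  have "fubini_study (F x) (cstruct Z) (dird y F x) = 0" for y
    by (rule Z(5)) (simp add: tangent_space_eq)
  with V Z umbilical_no_CR_triple[OF W F umb[OF WF], of v u w] show False
    by (simp add: eqs[symmetric] flip: cstruct_def)
qed

theorem corollary1p2:
  fixes n p :: nat
  assumes "n > 2" and "p \<ge> 1"
    and "CARD('n::finite) = n" and "2 * CARD('m::finite) = n + p"
  shows "\<not> (\<exists>(X :: 'a topology) (A :: ('a, real ^ 'n) chart set)
              (f :: 'a \<Rightarrow> (complex ^ 'm option) set).
            cproj_submanifold X A f \<and> CR_maximal_dim A f \<and>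
            flat_normal_connection A f \<and> totally_geodesic A f) \<and>
         \<not> (\<exists>(X :: 'a topology) (A :: ('a, real ^ 'n) chart set)
              (f :: 'a \<Rightarrow> (complex ^ 'm option) set).
            cproj_submanifold X A f \<and> CR_maximal_dim A f \<and>
            flat_normal_connection A f \<and> totally_umbilical A f)"
proof (intro conjI notI; elim exE conjE)
  fix X :: "'a topology" and A :: "('a, real ^ 'n) chart set" and f :: "'a \<Rightarrow> (complex ^ 'm option) set"
  assume M: "cproj_submanifold X A f" "CR_maximal_dim A f"
  \<comment> \<open>This makes the holomorphic tangent space, of dimension n - 1, nonzero.\<close>
  have n: "CARD('n) > 1"
    using assms by simp
  note rep = open_local_rep_domain[OF M(1)] local_rep_smooth[OF M(1)]
  {
    assume TG: "totally_geodesic A f"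
    show False
    proof (rule no_umbilical_CR_maximal_dim[OF M n])
      fix W F x assume WF: "(W, F) \<in> local_reps A cproj_atlas f" and x: "x \<in> W"
      have "second_fundamental_form fubini_study F x u v = 0" for u v
        using TG[unfolded totally_geodesic_def, THEN bspec, OF WF] x by simp
      then show "umbilical_at F x"
        by (rule totally_geodesic_umbilical_at[OF smooth_on_differentiable[OF rep(2)[OF WF] x]])
    qed
  next
    assume TU: "totally_umbilical A f"
    show False
    proof (rule no_umbilical_CR_maximal_dim[OF M n])
      fix W F x assume WF: "(W, F) \<in> local_reps A cproj_atlas f" and x: "x \<in> W"
      have "shape_operator fubini_study F x \<eta> u =
          fubini_study (F x) \<eta> (mean_curvature fubini_study F x) *\<^sub>R u"
        if "\<eta> \<in> normal_space fubini_study F x" for \<eta> u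
        using TU[unfolded totally_umbilical_def, THEN bspec, OF WF] x that by simp
      then show "umbilical_at F x"
        by (rule totally_umbilical_umbilical_at[OF rep(1)[OF WF] x rep(2)[OF WF] rep(3)[OF WF x]])
    qed
  }
qed

end
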